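(* Let $n\ge2$, $k\ge 1$ and $1\le\ell\le n-1$. The $nk$-dimensional Lebesgue measure $\mathrm{Vol}^{(n)}_{k,\ell}$ of the collection of bead configurations on $\mathbb{T}_n=[0,1)\times\mathbb{Z}_n$ with $k$ beads per string and occupation number $\ell$ is $$\mathrm{Vol}^{(n)}_{k,\ell}=\frac{(-1)^{k(\ell+1)}}{(nk)!}\sum_{0\le j_1<\cdots<j_\ell\le n-1}\left(e^{2\pi\iota j_1/n}+\cdots+e^{2\pi\iota j_\ell/n}\right)^{nk}.$$
   Context: $\iota=\sqrt{-1}$. $\mathbb{Z}_n=\mathbb{Z}/n\mathbb{Z}=\{0,\ldots,n-1\}$ and $\mathbb{T}_n=[0,1)\times\mathbb{Z}_n$ (string $h$ is $[0,1)\times\{h\}$); arithmetic on string labels is mod $n$. Bead configuration: for $k\ge1$, a collection of $nk$ distinct points of $\mathbb{T}_n$ with exactly $k$ points on each string such that for every $h\in\mathbb{Z}_n$, if $t_1<\cdots<t_k$ and $t_1'<\cdots<t_k'$ are the horizontal coordinates of the points on strings $h$ and $h+1$, then either $t_1\le t_1'<t_2\le t_2'<\cdots<t_k\le t_k'$ or $t_1'<t_1\le t_2'<t_2\le\cdots\le t_k'<t_k$. Occupation number: $\ell:=\#\{h\in\mathbb{Z}_n:\ \text{the smallest horizontal coordinate on string }h\text{ is strictly less than that on string }h-1\}$. A bead configuration is identified with the array $(t_{h,j})_{0\le h\le n-1,1\le j\le k}\in[0,1)^{nk}$, where $t_{h,j}$ is the horizontal coordinate of the $j$-th bead (in increasing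 order) on string $h$; Lebesgue measure is that of $[0,1)^{nk}$. *)

theory Defs
  imports "HOL-Analysis.Analysis"
begin

text \<open>A point \<open>(t, h)\<close> of \<open>{0..<1} \<times> {..<n}\<close> is the point of the string \<open>h\<close> with horizontal
  coordinate \<open>t\<close>; string labels are naturals below \<open>n\<close>, with arithmetic modulo \<open>n\<close> written out.\<close>

definition string_coords :: "(real \<times> nat) set \<Rightarrow> nat \<Rightarrow> real set" where
  "string_coords X h = {t. (t, h) \<in> X}"

text \<open>Beads on a string are numbered from \<open>1\<close>, whereas \<open>(!)\<close> counts from \<open>0\<close>.\<close>

definition bead_coord :: "(real \<times> nat) set \<Rightarrow> nat \<Rightarrow> nat \<Rightarrow> real" where
  "bead_coord X h j = sorted_list_of_set (string_coords X h) ! (j - 1)"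

text \<open>\<open>t 1 \<le> t' 1 < t 2 \<le> t' 2 < \<dots> < t k \<le> t' k\<close>\<close>

definition interlace_le :: "nat \<Rightarrow> (nat \<Rightarrow> real) \<Rightarrow> (nat \<Rightarrow> real) \<Rightarrow> bool" where
  "interlace_le k t t' \<longleftrightarrow> (\<forall>j\<in>{1..k}. t j \<le> t' j) \<and> (\<forall>j\<in>{1..<k}. t' j < t (j + 1))"

text \<open>\<open>t' 1 < t 1 \<le> t' 2 < t 2 \<le> \<dots> \<le> t' k < t k\<close>\<close>

definition interlace_less :: "nat \<Rightarrow> (nat \<Rightarrow> real) \<Rightarrow> (nat \<Rightarrow> real) \<Rightarrow> bool" where
  "interlace_less k t t' \<longleftrightarrow> (\<forall>j\<in>{1..k}. t' j < t j) \<and> (\<forall>j\<in>{1..<k}. t j \<le> t' (j + 1))"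

definition bead_configuration :: "nat \<Rightarrow> nat \<Rightarrow> (real \<times> nat) set \<Rightarrow> bool" where
  "bead_configuration n k X \<longleftrightarrow>
     finite X \<and> X \<subseteq> {0..<1} \<times> {..<n} \<and>
     (\<forall>h<n. card (string_coords X h) = k) \<and>
     (\<forall>h<n. interlace_le k (bead_coord X h) (bead_coord X ((h + 1) mod n)) \<or>
            interlace_less k (bead_coord X h) (bead_coord X ((h + 1) mod n)))"

text \<open>The predecessor \<open>h - 1\<close> is written \<open>(h + n - 1) mod n\<close>, as subtraction on naturals truncates.\<close>

definition occupation_number :: "nat \<Rightarrow> (real \<times> nat) set \<Rightarrow> nat" where
  "occupation_number n X =
     card {h. h < n \<and> Min (string_coords X h) < Min (string_coords X ((h + n - 1) mod n))}"

definition bead_array :: "nat \<Rightarrow> nat \<Rightarrow> (real \<times> nat) set \<Rightarrow> nat \<times> nat \<Rightarrow> real" where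
  "bead_array n k X = (\<lambda>(h, j)\<in>{..<n} \<times> {1..k}. bead_coord X h j)"

text \<open>The product of \<open>nk\<close> copies of \<^term>\<open>lborel\<close> is \<open>nk\<close>-dimensional Lebesgue measure on Borel
  sets. The set measured here is Borel, being a Boolean combination of linear inequalities, and
  lies in the unit cube, so that \<^const>\<open>measure\<close> loses no information.\<close>

definition bead_volume :: "nat \<Rightarrow> nat \<Rightarrow> nat \<Rightarrow> real" where
  "bead_volume n k l =
     measure (Pi\<^sub>M ({..<n} \<times> {1..k}) (\<lambda>_. lborel))
       (bead_array n k ` {X. bead_configuration n k X \<and> occupation_number n X = l})"

end

theory Submission imports Defs begin

text \<open>
  Almost every array of coordinates has \<open>n k\<close> distinct entries, and whether it is a bead
  configuration with a given occupation number depends only on the order of these entries. The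
  \<open>(n k)!\<close> orders are equally likely for a uniform point of the cube, since permuting the
  coordinates preserves Lebesgue measure. So the volume is the number of admissible orders divided by
  \<open>(n k)!\<close> (\<open>measure_order_invariant\<close>, \<open>bead_volume_eq_card\<close>).

  An admissible order is a closed walk of particles. Read the beads from left to right and record for
  each \<open>h\<close> which of the strings \<open>h - 1\<close> and \<open>h\<close> has the next bead; say that site \<open>h\<close> is occupied if it
  is string \<open>h\<close>. Interlacing makes the beads of neighbouring strings alternate, so a bead can appear on
  string \<open>h\<close> only if site \<open>h\<close> is occupied and site \<open>h + 1\<close> is empty, and afterwards the roles are
  exchanged: a particle has moved from \<open>h\<close> to \<open>h + 1\<close>. The number of particles is the occupation
  number \<open>l\<close>. With \<open>k\<close> beads on each string every edge of the ring is crossed \<open>k\<close> times and the initial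
  set of occupied sites returns after \<open>n k\<close> steps. Conversely a closed walk of \<open>n k\<close> steps carries the
  same current through all edges, hence exactly \<open>k\<close> across each of them. This is
  \<open>card_bead_patterns\<close>.

  Closed walks of mutually excluding particles are counted with free fermions. If \<open>z\<close> runs over the
  numbers with \<open>z\<^sup>n = (-1)\<^bsup>l - 1\<^esup>\<close>, the Slater determinant of \<open>l\<close> of them, evaluated at the occupied
  sites, is an eigenfunction of the one-step operator with eigenvalue the sum of these \<open>l\<close> numbers: a
  move onto an occupied site gives two equal rows, hence zero, and a particle that goes round the ring
  gives the factor \<open>z\<^sup>n\<close>, which is the sign of the cyclic permutation that sorts the positions
  again (\<open>power_slater_eigenfunction\<close>). The Slater determinants are orthogonal
  (\<open>slater_orthogonal\<close>), so the number of closed walks, a trace, is the sum of the \<open>n k\<close>-th powers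
  of the eigenvalues (\<open>sum_closed_walks\<close>). Writing \<open>z = \<zeta> e\<^bsup>2 \<pi> \<i> j / n\<^esup>\<close> and extracting
  \<open>\<zeta>\<^bsup>n k\<^esup> = (-1)\<^bsup>(l - 1) k\<^esup>\<close> gives the formula.
\<close>

section \<open>Alternating sums over permutations\<close>

text \<open>The determinant of a \<open>d \<times> d\<close> matrix by the Leibniz formula. The size is a number rather than a type,
  since it will be the number of elements of a set.\<close>

definition alt_sum :: "nat \<Rightarrow> (nat \<Rightarrow> nat \<Rightarrow> complex) \<Rightarrow> complex" where
  "alt_sum d F = (\<Sum>p | p permutes {..<d}. of_int (sign p) * (\<Prod>i<d. F i (p i)))"

lemma alt_sum_cong:
  assumes "\<And>i j. i < d \<Longrightarrow> j < d \<Longrightarrow> F i j = G i j"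
  shows "alt_sum d F = alt_sum d G"
proof -
  have "p i < d" if "p permutes {..<d}" "i < d" for p i
    using permutes_in_image[OF that(1), of i] that(2) by simp
  then show ?thesis
    unfolding alt_sum_def by (intro sum.cong arg_cong2[where f="(*)"] prod.cong refl) (auto simp: assms)
qed

lemma alt_sum_transpose: "alt_sum d (\<lambda>i j. F j i) = alt_sum d F"
proof -
  have "alt_sum d F = (\<Sum>p | p permutes {..<d}. of_int (sign (inv p)) * (\<Prod>i<d. F i (inv p i)))"
    unfolding alt_sum_def by (rule sum_permutations_inverse)
  also have "\<dots> = (\<Sum>p | p permutes {..<d}. of_int (sign p) * (\<Prod>i<d. F (p i) i))"
  proof (rule sum.cong[OF refl], clarify)
    fix p assume p: "p permutes {..<d}"
    have "(\<Prod>i<d. F i (inv p i)) = (\<Prod>i<d. F (p i) (inv p (p i)))"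
      using prod.permute[OF p, of "\<lambda>i. F i (inv p i)"] by (simp add: o_def)
    with p show "of_int (sign (inv p)) * (\<Prod>i<d. F i (inv p i)) = of_int (sign p) * (\<Prod>i<d. F (p i) i)"
      by (simp add: sign_inverse permutes_imp_permutation[OF finite_lessThan] permutes_inverses)
  qed
  finally show ?thesis unfolding alt_sum_def by simp
qed

lemma alt_sum_permute_cols:
  assumes p: "p permutes {..<d}"
  shows "alt_sum d (\<lambda>i j. F i (p j)) = of_int (sign p) * alt_sum d F"
proof -
  have "alt_sum d F = (\<Sum>q | q permutes {..<d}. of_int (sign (p \<circ> q)) * (\<Prod>i<d. F i (p (q i))))"
    unfolding alt_sum_def using setum_permutations_compose_left[OF p, of "\<lambda>q. of_int (sign q) * (\<Prod>i<d. F i (q i))"]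
    by (simp add: o_def)
  also have "\<dots> = of_int (sign p) * alt_sum d (\<lambda>i j. F i (p j))"
    unfolding alt_sum_def sum_distrib_left
    using p by (intro sum.cong refl) (auto simp: sign_compose permutes_imp_permutation[OF finite_lessThan])
  finally show ?thesis
    by (simp flip: mult.assoc of_int_mult)
qed

lemma alt_sum_permute_rows:
  assumes p: "p permutes {..<d}"
  shows "alt_sum d (\<lambda>i j. F (p i) j) = of_int (sign p) * alt_sum d F"
  using alt_sum_permute_cols[OF p, of "\<lambda>i j. F j i"]
  by (simp add: alt_sum_transpose[of d F] alt_sum_transpose[of d "\<lambda>i. F (p i)"])

lemma alt_sum_equal_cols:
  assumes "a < d" "b < d" "a \<noteq> b" "\<And>i. i < d \<Longrightarrow> F i a = F i b"
  shows "alt_sum d F = 0"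
proof -
  have t: "Transposition.transpose a b permutes {..<d}"
    using assms by (intro permutes_swap_id) auto
  have "alt_sum d F = alt_sum d (\<lambda>i j. F i (Transposition.transpose a b j))"
    using assms by (intro alt_sum_cong) (auto simp: Transposition.transpose_def)
  also have "\<dots> = - alt_sum d F"
    using alt_sum_permute_cols[OF t, of F] \<open>a \<noteq> b\<close> by (simp add: sign_swap_id)
  finally show ?thesis by simp
qed

lemma alt_sum_equal_rows:
  assumes "a < d" "b < d" "a \<noteq> b" "\<And>j. j < d \<Longrightarrow> F a j = F b j"
  shows "alt_sum d F = 0"
  using alt_sum_equal_cols[OF assms(1-3), of "\<lambda>i j. F j i"] assms(4)
  by (simp add: alt_sum_transpose[of d F])

text \<open>Moving the last index to the front is a cycle of length \<open>d + 1\<close>, built up here by one transposition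
  for each further index; its sign is what a particle picks up on its way round a ring.\<close>

lemma rotation_permutation:
  "\<exists>r. r permutes {..<Suc d} \<and> sign r = (-1) ^ d \<and> r 0 = d \<and> (\<forall>i<d. r (Suc i) = i)"
proof (induction d)
  case 0
  show ?case by (intro exI[of _ id]) (simp add: permutes_id[unfolded id_def] id_def)
next
  case (Suc d)
  then obtain r where r: "r permutes {..<Suc d}" "sign r = (-1) ^ d" "r 0 = d" "\<forall>i<d. r (Suc i) = i"
    by blast
  let ?t = "Transposition.transpose d (Suc d)"
  have t: "?t permutes {..<Suc (Suc d)}" by (intro permutes_swap_id) auto
  have r': "r permutes {..<Suc (Suc d)}" by (rule permutes_subset[OF r(1)]) auto
  have fx: "r (Suc d) = Suc d" using permutes_not_in[OF r(1), of "Suc d"] by simp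
  have "sign (?t \<circ> r) = (-1) ^ Suc d"
    using t r' r(2) by (subst sign_compose) (auto simp: sign_swap_id permutes_imp_permutation[OF finite_lessThan])
  moreover have "(?t \<circ> r) (Suc i) = i" if "i < Suc d" for i
    using that r(4) fx by (cases "i = d") (auto simp: Transposition.transpose_def)
  ultimately show ?case
    using permutes_compose[OF r' t] r(3) by (intro exI[of _ "?t \<circ> r"]) (simp add: Transposition.transpose_def del: o_apply, simp)
qed

lemma alt_sum_rotate_rows:
  "alt_sum (Suc d) (\<lambda>i. if i = 0 then F d else F (i - 1)) = (-1) ^ d * alt_sum (Suc d) F"
proof -
  obtain r where r: "r permutes {..<Suc d}" "sign r = (-1) ^ d" "r 0 = d" "\<forall>i<d. r (Suc i) = i"
    using rotation_permutation by blast
  have "alt_sum (Suc d) (\<lambda>i. if i = 0 then F d else F (i - 1)) = alt_sum (Suc d) (\<lambda>i j. F (r i) j)"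
    using r by (intro alt_sum_cong) (auto simp: gr0_conv_Suc)
  then show ?thesis using alt_sum_permute_rows[OF r(1)] r(2) by simp
qed

section \<open>Orthogonality of Slater determinants\<close>

text \<open>Sets of sites and sets of modes are enumerated in increasing order, which fixes the sign of the
  determinants below.\<close>

abbreviation elem :: "nat set \<Rightarrow> nat \<Rightarrow> nat" where
  "elem S i \<equiv> sorted_list_of_set S ! i"

definition slater :: "(nat \<Rightarrow> nat \<Rightarrow> complex) \<Rightarrow> nat set \<Rightarrow> nat set \<Rightarrow> complex" where
  "slater f S J = alt_sum (card S) (\<lambda>i j. f (elem S i) (elem J j))"

lemma slater_swap: "card S = card J \<Longrightarrow> slater f S J = slater (\<lambda>j s. f s j) J S"
  unfolding slater_def
  using alt_sum_transpose[of "card J" "\<lambda>i j. f (elem S i) (elem J j)"] by simp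

lemma bij_betw_elem:
  assumes "finite S" "card S = d" shows "bij_betw (elem S) {..<d} S"
  using assms by (intro bij_betw_nth) (auto simp: )

lemma elem_permutation_imp_id:
  assumes "finite S" "finite T" "card S = d" "card T = d" "q permutes {..<d}"
    and eq: "\<And>i. i < d \<Longrightarrow> elem S i = elem T (q i)"
  shows "S = T \<and> q = id"
proof -
  have "elem S ` {..<d} = S" "elem T ` {..<d} = T"
    using bij_betw_elem assms by (blast dest: bij_betw_imp_surj_on)+
  moreover have "q ` {..<d} = {..<d}" using assms(5) by (rule permutes_image)
  ultimately have ST: "S = T" using eq by (metis (no_types, lifting) image_cong image_image lessThan_iff)
  have "q i = i" for i
  proof (cases "i < d")
    case True
    then have "q i < d" using permutes_in_image[OF assms(5), of i] by simp
    then show ?thesis using True eq[OF True] ST assms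
      by (auto simp: nth_eq_iff_index_eq)
  next
    case False
    then show ?thesis using permutes_not_in[OF assms(5)] by simp
  qed
  with ST show ?thesis by auto
qed

text \<open>This parametrization by permutations is used twice: to recover a sum over tuples of distinct modes from
  the Leibniz formula, and to count the rankings of a finite set.\<close>

lemma bij_betw_permutes_bijections:
  assumes e: "bij_betw e A B"
  shows "bij_betw (\<lambda>p. restrict (e \<circ> p) A) {p. p permutes A} {g \<in> A \<rightarrow>\<^sub>E B. bij_betw g A B}"
proof (rule bij_betwI')
  fix p q assume pq: "p \<in> {p. p permutes A}" "q \<in> {p. p permutes A}"
  show "(restrict (e \<circ> p) A = restrict (e \<circ> q) A) = (p = q)"
  proof
    assume r: "restrict (e \<circ> p) A = restrict (e \<circ> q) A"
    show "p = q"
    proof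
      fix i show "p i = q i"
      proof (cases "i \<in> A")
        case True
        then have "e (p i) = e (q i)" using fun_cong[OF r, of i] by simp
        moreover have "p i \<in> A" "q i \<in> A" using pq permutes_in_image[of _ A i] True by auto
        ultimately show ?thesis using e by (auto simp: bij_betw_def inj_on_def)
      next
        case False then show ?thesis using pq by (auto simp: permutes_def)
      qed
    qed
  qed simp
next
  fix p assume "p \<in> {p. p permutes A}"
  then have "bij_betw (e \<circ> p) A B"
    using e permutes_imp_bij bij_betw_trans by blast
  then show "restrict (e \<circ> p) A \<in> {g \<in> A \<rightarrow>\<^sub>E B. bij_betw g A B}"
    by (auto simp: bij_betw_def)
next
  fix g assume g: "g \<in> {g \<in> A \<rightarrow>\<^sub>E B. bij_betw g A B}"
  define p where "p i = (if i \<in> A then inv_into A e (g i) else i)" for i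
  have "bij_betw (inv_into A e \<circ> g) A A"
    using g bij_betw_inv_into[OF e] by (auto intro: bij_betw_trans)
  then have "bij_betw p A A" by (subst bij_betw_cong[where g="inv_into A e \<circ> g"]) (auto simp: p_def)
  then have "p permutes A" by (intro bij_imp_permutes) (auto simp: p_def)
  moreover have "g = restrict (e \<circ> p) A"
  proof
    fix i show "g i = restrict (e \<circ> p) A i"
    proof (cases "i \<in> A")
      case True
      then have "g i \<in> e ` A" using g e by (auto simp: bij_betw_def)
      with True show ?thesis by (simp add: p_def f_inv_into_f)
    next
      case False with g show ?thesis by (auto simp: PiE_def extensional_def)
    qed
  qed
  ultimately show "\<exists>p\<in>{p. p permutes A}. g = restrict (e \<circ> p) A" by blast
qed

lemma sum_over_arrangements:
  assumes "finite J" "card J = d"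
  shows "(\<Sum>p | p permutes {..<d}. F (restrict (elem J \<circ> p) {..<d})) =
         (\<Sum>g | g \<in> {..<d} \<rightarrow>\<^sub>E J \<and> inj_on g {..<d}. F g)"
proof -
  have "bij_betw g {..<d} J \<longleftrightarrow> inj_on g {..<d}" if "g \<in> {..<d} \<rightarrow>\<^sub>E J" for g
  proof
    assume "inj_on g {..<d}"
    moreover from this have "g ` {..<d} = J"
      using that assms by (intro card_subset_eq) (auto simp: card_image)
    ultimately show "bij_betw g {..<d} J" by (simp add: bij_betw_def)
  qed (simp add: bij_betw_def)
  then have "{g \<in> {..<d} \<rightarrow>\<^sub>E J. bij_betw g {..<d} J} = {g. g \<in> {..<d} \<rightarrow>\<^sub>E J \<and> inj_on g {..<d}}"
    by blast
  then show ?thesis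
    using sum.reindex_bij_betw[OF bij_betw_permutes_bijections[OF bij_betw_elem[OF assms]], of F] by simp
qed

text \<open>The Cauchy-Binet argument. Unfolding only the first determinant turns the sum over sets \<open>J\<close> and
  permutations into a sum over injective tuples of modes. The injectivity may be dropped, since the second
  determinant vanishes on the other tuples, and then the sum factorizes into one-particle sums,
  which are orthogonal by assumption.\<close>

lemma slater_orthogonal:
  fixes f g :: "nat \<Rightarrow> nat \<Rightarrow> complex"
  assumes S: "S \<subseteq> {..<n}" "card S = d" and T: "T \<subseteq> {..<n}" "card T = d"
    and orth: "\<And>a b. a < n \<Longrightarrow> b < n \<Longrightarrow> (\<Sum>c<n. f a c * g b c) = (if a = b then N else 0)"
  shows "(\<Sum>J | J \<subseteq> {..<n} \<and> card J = d. slater f S J * slater g T J) = (if S = T then N ^ d else 0)"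
proof -
  define Js where "Js = {J. J \<subseteq> {..<n} \<and> card J = d}"
  have fin: "finite S" "finite T" using S T by (auto intro: finite_subset)
  have finJ: "finite J" if "J \<in> Js" for J using that by (auto simp: Js_def intro: finite_subset)
  have finJs: "finite Js" unfolding Js_def by (rule finite_subset[of _ "Pow {..<n}"]) auto
  have Slt: "elem S i < n" "elem T i < n" if "i < d" for i
    using S T bij_betw_elem[OF fin(1) S(2)] bij_betw_elem[OF fin(2) T(2)] that
    by (auto simp: bij_betw_def)
  define G where "G c = alt_sum d (\<lambda>i j. g (elem T i) (c j))" for c
  define W where "W c = (\<Prod>i<d. f (elem S i) (c i)) * G c" for c
  have W_restrict: "W (restrict c {..<d}) = W c" for c
    unfolding W_def G_def by (intro arg_cong2[where f="(*)"] prod.cong alt_sum_cong) auto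
  have "slater f S J * slater g T J = (\<Sum>c | c \<in> {..<d} \<rightarrow>\<^sub>E J \<and> inj_on c {..<d}. W c)" if J: "J \<in> Js" for J
  proof -
    have A: "slater f S J * slater g T J = (\<Sum>p | p permutes {..<d}. (\<Prod>i<d. f (elem S i) (elem J (p i))) * (of_int (sign p) * G (elem J)))"
      unfolding slater_def S T G_def sum_distrib_right alt_sum_def[of d "\<lambda>i j. f (elem S i) (elem J j)"]
      by (simp add: mult_ac)
    \<comment> \<open>The sign of the permutation is absorbed by permuting the columns of the second determinant.\<close>
    have B: "(\<Sum>p | p permutes {..<d}. (\<Prod>i<d. f (elem S i) (elem J (p i))) * (of_int (sign p) * G (elem J))) =
        (\<Sum>p | p permutes {..<d}. W (restrict (elem J \<circ> p) {..<d}))"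
      unfolding W_restrict
    proof (rule sum.cong[OF refl], clarify)
      fix p assume "p permutes {..<d}"
      from alt_sum_permute_cols[OF this, of "\<lambda>i j. g (elem T i) (elem J j)"]
      show "(\<Prod>i<d. f (elem S i) (elem J (p i))) * (of_int (sign p) * G (elem J)) = W (elem J \<circ> p)"
        by (simp add: W_def G_def)
    qed
    have C: "(\<Sum>p | p permutes {..<d}. W (restrict (elem J \<circ> p) {..<d})) =
        (\<Sum>c | c \<in> {..<d} \<rightarrow>\<^sub>E J \<and> inj_on c {..<d}. W c)"
      using J finJ[OF J] by (intro sum_over_arrangements[of J d W]) (simp_all add: Js_def)
    show ?thesis by (simp only: A B C)
  qed
  then have "(\<Sum>J\<in>Js. slater f S J * slater g T J) =
      (\<Sum>J\<in>Js. \<Sum>c | c \<in> {..<d} \<rightarrow>\<^sub>E J \<and> inj_on c {..<d}. W c)" by simp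
  also have "\<dots> = sum W (\<Union>J\<in>Js. {c \<in> {..<d} \<rightarrow>\<^sub>E J. inj_on c {..<d}})"
  proof (rule sum.UNION_disjoint[symmetric, OF finJs])
    show "\<forall>J\<in>Js. finite {c \<in> {..<d} \<rightarrow>\<^sub>E J. inj_on c {..<d}}"
      using finJ by (auto simp: finite_PiE)
    have im: "c ` {..<d} = J" if "J \<in> Js" "c \<in> {..<d} \<rightarrow>\<^sub>E J" "inj_on c {..<d}" for c J
      using that finJ[of J] by (intro card_subset_eq) (auto simp: card_image Js_def)
    show "\<forall>J\<in>Js. \<forall>K\<in>Js. J \<noteq> K \<longrightarrow>
       {c \<in> {..<d} \<rightarrow>\<^sub>E J. inj_on c {..<d}} \<inter> {c \<in> {..<d} \<rightarrow>\<^sub>E K. inj_on c {..<d}} = {}"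
    proof (intro ballI impI equals0I)
      fix J K c assume "J \<in> Js" "K \<in> Js" "J \<noteq> K"
        and "c \<in> {c \<in> {..<d} \<rightarrow>\<^sub>E J. inj_on c {..<d}} \<inter> {c \<in> {..<d} \<rightarrow>\<^sub>E K. inj_on c {..<d}}"
      then show False using im[of J c] im[of K c] by simp
    qed
  qed
  \<comment> \<open>A tuple with a repeated mode gives two equal columns.\<close>
  also have "\<dots> = sum W ({..<d} \<rightarrow>\<^sub>E {..<n})"
  proof (rule sum.mono_neutral_left)
    show "\<forall>c\<in>({..<d} \<rightarrow>\<^sub>E {..<n}) - (\<Union>J\<in>Js. {c \<in> {..<d} \<rightarrow>\<^sub>E J. inj_on c {..<d}}). W c = 0"
    proof
      fix c assume c: "c \<in> ({..<d} \<rightarrow>\<^sub>E {..<n}) - (\<Union>J\<in>Js. {c \<in> {..<d} \<rightarrow>\<^sub>E J. inj_on c {..<d}})"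
      have "\<not> inj_on c {..<d}"
      proof
        assume inj: "inj_on c {..<d}"
        with c have "c ` {..<d} \<in> Js" by (auto simp: Js_def card_image)
        moreover have "c \<in> {..<d} \<rightarrow>\<^sub>E c ` {..<d}" using c by (auto simp: PiE_def)
        ultimately show False using c inj by blast
      qed
      then obtain a b where "a < d" "b < d" "a \<noteq> b" "c a = c b" by (auto simp: inj_on_def)
      then have "G c = 0" unfolding G_def by (intro alt_sum_equal_cols[of a _ b]) auto
      then show "W c = 0" by (simp add: W_def)
    qed
  qed (auto simp: Js_def intro!: finite_PiE)
  also have "\<dots> = (\<Sum>q | q permutes {..<d}. of_int (sign q) *
      (\<Prod>i<d. \<Sum>c<n. f (elem S i) c * g (elem T (q i)) c))"
  proof -
    have "W c = (\<Sum>q | q permutes {..<d}. of_int (sign q) * (\<Prod>i<d. f (elem S i) (c i) * g (elem T (q i)) (c i)))" for c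
    proof -
      have "G c = (\<Sum>q | q permutes {..<d}. of_int (sign q) * (\<Prod>i<d. g (elem T (q i)) (c i)))"
        unfolding G_def using alt_sum_transpose[of d "\<lambda>i j. g (elem T i) (c j)"] by (simp add: alt_sum_def)
      then show ?thesis unfolding W_def by (simp add: sum_distrib_left prod.distrib mult_ac)
    qed
    \<comment> \<open>The second determinant is now expanded as well, after which each particle is summed separately.\<close>
    then have "sum W ({..<d} \<rightarrow>\<^sub>E {..<n}) = (\<Sum>q | q permutes {..<d}. \<Sum>c\<in>({..<d} \<rightarrow>\<^sub>E {..<n}).
        of_int (sign q) * (\<Prod>i<d. f (elem S i) (c i) * g (elem T (q i)) (c i)))"
      by (simp add: sum.swap[of _ "{..<d} \<rightarrow>\<^sub>E {..<n}"])
    then show ?thesis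
      by (simp add: prod_sum_PiE flip: sum_distrib_left)
  qed
  \<comment> \<open>Both enumerations are increasing, so they can agree up to a permutation only if it is trivial.\<close>
  also have "\<dots> = (\<Sum>q | q permutes {..<d}. if S = T \<and> q = id then N ^ d else 0)"
  proof (rule sum.cong[OF refl], clarify)
    fix q assume q: "q permutes {..<d}"
    have qlt: "q i < d" if "i < d" for i using permutes_in_image[OF q, of i] that by simp
    have *: "(\<Prod>i<d. \<Sum>c<n. f (elem S i) c * g (elem T (q i)) c) = (\<Prod>i<d. if elem S i = elem T (q i) then N else 0)"
      using Slt qlt by (intro prod.cong refl orth) auto
    show "of_int (sign q) * (\<Prod>i<d. \<Sum>c<n. f (elem S i) c * g (elem T (q i)) c) = (if S = T \<and> q = id then N ^ d else 0)"
    proof (cases "S = T \<and> q = id")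
      case True
      then show ?thesis unfolding * by simp
    next
      case False
      then obtain i where "i < d" "elem S i \<noteq> elem T (q i)"
        using elem_permutation_imp_id[OF fin S(2) T(2) q] by blast
      then have "(\<Prod>i<d. if elem S i = elem T (q i) then N else 0) = 0" by (intro prod_zero) auto
      with False show ?thesis unfolding * by simp
    qed
  qed
  also have "\<dots> = (if S = T then N ^ d else 0)"
    by (simp add: finite_permutations permutes_id)
  finally show ?thesis unfolding Js_def .
qed

section \<open>Slater determinants as eigenfunctions of particle hopping\<close>

lemma sorted_list_of_set_image:
  fixes x :: "nat \<Rightarrow> 'a :: linorder"
  assumes "strict_mono_on {..<d} x"
  shows "sorted_list_of_set (x ` {..<d}) = map x [0..<d]"
proof (rule sorted_distinct_set_unique)
  show "sorted (map x [0..<d])"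
    using assms by (auto simp: sorted_iff_nth_mono strict_mono_on_leD)
  show "distinct (map x [0..<d])"
    using assms strict_mono_on_imp_inj_on[OF assms] by (simp add: distinct_map lessThan_atLeast0)
qed (auto simp: lessThan_atLeast0)

lemma elem_eqI:
  assumes "strict_mono_on {..<d} x" "x ` {..<d} = S" "i < d"
  shows "elem S i = x i"
  using sorted_list_of_set_image[OF assms(1)] assms by auto

lemma elem_less: "i < j \<Longrightarrow> j < card S \<Longrightarrow> elem S i < elem S j"
  using strict_sorted_list_of_set[of S] by (simp add: sorted_wrt_iff_nth_less)

lemma alt_sum_scale_row:
  assumes "a < d"
  shows "alt_sum d (\<lambda>i j. if i = a then c * F i j else F i j) = c * alt_sum d F"
proof -
  have "(\<Prod>i<d. if i = a then c * F i (p i) else F i (p i)) = c * (\<Prod>i<d. F i (p i))" for p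
    using assms by (simp add: prod.remove[of _ a])
  then show ?thesis unfolding alt_sum_def by (simp add: sum_distrib_left mult_ac)
qed

text \<open>Occupied sites of the ring of \<open>n\<close> sites form a set, and a particle may move from \<open>h\<close> to the next site if
  that site is empty.\<close>

definition can_hop :: "nat \<Rightarrow> nat set \<Rightarrow> nat \<Rightarrow> bool" where
  "can_hop n S h \<longleftrightarrow> h \<in> S \<and> Suc h mod n \<notin> S"

definition hop :: "nat \<Rightarrow> nat \<Rightarrow> nat set \<Rightarrow> nat set" where
  "hop n h S = insert (Suc h mod n) (S - {h})"

lemma hop_subset: "can_hop n S h \<Longrightarrow> S \<subseteq> {..<n} \<Longrightarrow> hop n h S \<subseteq> {..<n}"
  by (cases n) (auto simp: can_hop_def hop_def)

lemma card_hop: "can_hop n S h \<Longrightarrow> finite S \<Longrightarrow> card (hop n h S) = card S"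
  using card.remove[of S h] by (auto simp: can_hop_def hop_def)

text \<open>The wave function of free fermions with momenta \<open>z j\<close>, \<open>j \<in> J\<close>, at the positions \<open>S\<close>.\<close>

definition power_slater :: "(nat \<Rightarrow> complex) \<Rightarrow> nat set \<Rightarrow> nat set \<Rightarrow> complex" where
  "power_slater z S J = slater (\<lambda>s j. z j ^ s) S J"

text \<open>Raising the exponent of row \<open>b\<close> multiplies the term of the permutation \<open>p\<close> by \<open>z (p b)\<close>; summed over
  the rows this is the same factor for all permutations, so unconstrained motion acts on the determinant
  as a scalar.\<close>

lemma sum_alt_sum_increment:
  fixes z :: "nat \<Rightarrow> complex"
  shows "(\<Sum>b<d. alt_sum d (\<lambda>i j. z j ^ (x(b := Suc (x b))) i)) = (\<Sum>j<d. z j) * alt_sum d (\<lambda>i j. z j ^ x i)"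
proof -
  have "(\<Prod>i<d. z (p i) ^ (x(b := Suc (x b))) i) = z (p b) * (\<Prod>i<d. z (p i) ^ x i)" if "b < d" for b p
    using that by (simp add: prod.remove[of _ b])
  then have "(\<Sum>b<d. alt_sum d (\<lambda>i j. z j ^ (x(b := Suc (x b))) i)) =
      (\<Sum>b<d. \<Sum>p | p permutes {..<d}. of_int (sign p) * (z (p b) * (\<Prod>i<d. z (p i) ^ x i)))"
    unfolding alt_sum_def by (intro sum.cong refl) simp
  also have "\<dots> = (\<Sum>p | p permutes {..<d}. of_int (sign p) * ((\<Sum>b<d. z (p b)) * (\<Prod>i<d. z (p i) ^ x i)))"
    by (subst sum.swap) (simp add: sum_distrib_left sum_distrib_right)
  also have "\<dots> = (\<Sum>p | p permutes {..<d}. of_int (sign p) * ((\<Sum>b<d. z b) * (\<Prod>i<d. z (p i) ^ x i)))"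
  proof (rule sum.cong[OF refl], clarify)
    fix p assume "p permutes {..<d}"
    then have "(\<Sum>b<d. z (p b)) = (\<Sum>b<d. z b)"
      using sum.permute[of p "{..<d}" z] by (simp add: o_def)
    then show "of_int (sign p) * ((\<Sum>b<d. z (p b)) * (\<Prod>i<d. z (p i) ^ x i)) =
       of_int (sign p) * ((\<Sum>b<d. z b) * (\<Prod>i<d. z (p i) ^ x i))" by simp
  qed
  finally show ?thesis unfolding alt_sum_def by (simp add: sum_distrib_left mult_ac)
qed

text \<open>The exponents \<open>x(b := x b + 1)\<close> are the positions after an unconstrained move. If the target is occupied, two
  rows coincide. If the target is \<open>n\<close>, the condition on \<open>z\<close> identifies position \<open>n\<close> with
  position \<open>0\<close>, up to the sign \<open>(-1)\<^bsup>d - 1\<^esup>\<close> that the rotation of the rows cancels.\<close>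

lemma power_slater_increment:
  fixes z :: "nat \<Rightarrow> complex"
  assumes n: "n \<ge> 2" and S: "S \<subseteq> {..<n}" "card S = d" and J: "finite J" "card J = d"
    and z: "\<And>j. j \<in> J \<Longrightarrow> z j ^ n = (-1) ^ (d - 1)" and b: "b < d"
  defines "x \<equiv> elem S"
  shows "alt_sum d (\<lambda>i j. z (elem J j) ^ (x(b := Suc (x b))) i) =
         (if can_hop n S (x b) then power_slater z (hop n (x b) S) J else 0)"
proof -
  have fin: "finite S" using S by (auto intro: finite_subset)
  have bij: "bij_betw x {..<d} S" unfolding x_def using fin S(2) by (rule bij_betw_elem)
  have xS: "x i \<in> S" if "i < d" for i using bij that by (auto simp: bij_betw_def)
  have x_less: "x i < x j" if "i < j" "j < d" for i j
    unfolding x_def using that S by (simp add: elem_less)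
  have zJ: "z (elem J j) ^ n = (-1) ^ (d - 1)" if "j < d" for j
    using bij_betw_elem[OF J] that by (intro z) (auto simp: bij_betw_def)
  have xn: "x i < n" if "i < d" for i using xS[OF that] S by auto
  have slater_hop: "alt_sum d (\<lambda>i j. z (elem J j) ^ y i) = power_slater z (hop n (x b) S) J"
    if "can_hop n S (x b)" "\<And>i j. i < j \<Longrightarrow> j < d \<Longrightarrow> y i < y j" "y ` {..<d} = hop n (x b) S" for y
  proof -
    have "elem (hop n (x b) S) i = y i" if "i < d" for i
      using that \<open>y ` {..<d} = hop n (x b) S\<close> that(1)
      by (intro elem_eqI[of d y]) (auto simp: strict_mono_on_def intro: \<open>\<And>i j. i < j \<Longrightarrow> j < d \<Longrightarrow> y i < y j\<close>)
    then show ?thesis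
      using that(1) fin S(2) by (auto simp: power_slater_def slater_def card_hop intro!: alt_sum_cong)
  qed
  have image_upd: "(x(b := v)) ` {..<d} = insert v (S - {x b})" for v
  proof -
    have "(x(b := v)) ` {..<d} = insert v (x ` ({..<d} - {b}))" using b by (auto simp: image_iff)
    also have "x ` ({..<d} - {b}) = S - {x b}" using bij b by (auto simp: bij_betw_def inj_on_def)
    finally show ?thesis .
  qed
  consider (blocked) "Suc (x b) < n" "Suc (x b) \<in> S" | (free) "Suc (x b) < n" "Suc (x b) \<notin> S" | (wrap) "Suc (x b) = n"
    using xn[OF b] by linarith
  then show ?thesis
  proof cases
    case blocked
    obtain c where c: "c < d" "x c = Suc (x b)" using blocked(2) bij by (auto simp: bij_betw_def image_iff)
    then have "alt_sum d (\<lambda>i j. z (elem J j) ^ (x(b := Suc (x b))) i) = 0"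
      using b by (intro alt_sum_equal_rows[of b d c]) auto
    with blocked show ?thesis by (simp add: can_hop_def)
  next
    case free
    then have can: "can_hop n S (x b)" using xS[OF b] by (simp add: can_hop_def)
    have "(x(b := Suc (x b))) i < (x(b := Suc (x b))) j" if "i < j" "j < d" for i j
    proof -
      have "x j \<noteq> Suc (x b)" using xS[OF that(2)] free(2) by auto
      with x_less[OF that] show ?thesis using that by auto
    qed
    moreover have "(x(b := Suc (x b))) ` {..<d} = hop n (x b) S"
      using free(1) image_upd by (simp add: hop_def del: fun_upd_apply)
    ultimately have "alt_sum d (\<lambda>i j. z (elem J j) ^ (x(b := Suc (x b))) i) = power_slater z (hop n (x b) S) J"
      by (rule slater_hop[OF can])
    then show ?thesis using can by simp
  next
    case wrap
    obtain e where d: "d = Suc e" using b by (cases d) auto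
    have be: "b = e"
    proof (rule ccontr)
      assume "b \<noteq> e"
      then have "x b < x e" using b d by (intro x_less) auto
      then show False using wrap xn[of e] d by simp
    qed
    \<comment> \<open>The positions after the move in increasing order: site 0 comes first and the others are shifted by one place.\<close>
    define y where "y i = (if i = 0 then 0 else x (i - 1))" for i
    define F where "F i j = z (elem J j) ^ (x(b := Suc (x b))) i" for i j
    have "(-1) ^ e * alt_sum d F = alt_sum d (\<lambda>i. if i = 0 then F e else F (i - 1))"
      unfolding d by (rule alt_sum_rotate_rows[symmetric])
    also have "\<dots> = alt_sum d (\<lambda>i j. if i = 0 then (-1) ^ e * z (elem J j) ^ y i else z (elem J j) ^ y i)"
      using wrap zJ by (intro alt_sum_cong) (auto simp: F_def be y_def d)
    also have "\<dots> = (-1) ^ e * alt_sum d (\<lambda>i j. z (elem J j) ^ y i)"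
      by (rule alt_sum_scale_row) (simp add: d)
    finally have rot: "alt_sum d F = alt_sum d (\<lambda>i j. z (elem J j) ^ y i)" by simp
    show ?thesis
    proof (cases "0 \<in> S")
      case True
      then obtain a where a: "a < d" "x a = 0" using bij by (auto simp: bij_betw_def image_iff)
      then have "a = 0" using x_less[of 0 a] by (cases a) auto
      with a have "x 0 = 0" by simp
      \<comment> \<open>A single particle cannot block itself, as the ring has at least two sites.\<close>
      moreover from this have "e \<noteq> 0" using wrap n be by (cases e) auto
      ultimately have "alt_sum d (\<lambda>i j. z (elem J j) ^ y i) = 0"
        by (intro alt_sum_equal_rows[of 0 d 1]) (auto simp: y_def d)
      with rot have "alt_sum d F = 0" by simp
      with True wrap show ?thesis by (simp add: can_hop_def F_def[abs_def])
    next
      case False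
      then have can: "can_hop n S (x b)" using xS[OF b] wrap by (simp add: can_hop_def)
      have "y i < y j" if "i < j" "j < d" for i j
      proof (cases "i = 0")
        case True
        have "x (j - 1) \<noteq> 0" using \<open>0 \<notin> S\<close> xS[of "j - 1"] that by (metis less_imp_diff_less)
        with True that show ?thesis by (simp add: y_def)
      next
        case False with that show ?thesis by (auto simp: y_def intro!: x_less)
      qed
      moreover have "y ` {..<d} = hop n (x b) S"
      proof -
        have "y ` {..<d} = insert 0 (x ` {..<e})"
          unfolding d lessThan_Suc_eq_insert_0 image_insert image_image by (simp add: y_def)
        also have "{..<e} = {..<d} - {b}" using d be by auto
        also have "x ` ({..<d} - {b}) = S - {x b}" using bij b by (auto simp: bij_betw_def inj_on_def)
        finally show ?thesis using wrap by (simp add: hop_def)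
      qed
      ultimately have "alt_sum d (\<lambda>i j. z (elem J j) ^ y i) = power_slater z (hop n (x b) S) J"
        by (rule slater_hop[OF can])
      then show ?thesis using rot can by (simp add: F_def[abs_def])
    qed
  qed
qed

lemma power_slater_eigenfunction:
  fixes z :: "nat \<Rightarrow> complex"
  assumes n: "n \<ge> 2" and S: "S \<subseteq> {..<n}" "card S = d" and J: "finite J" "card J = d"
    and z: "\<And>j. j \<in> J \<Longrightarrow> z j ^ n = (-1) ^ (d - 1)"
  shows "(\<Sum>h | can_hop n S h. power_slater z (hop n h S) J) = (\<Sum>j\<in>J. z j) * power_slater z S J"
proof -
  have fin: "finite S" using S by (auto intro: finite_subset)
  have "(\<Sum>h | can_hop n S h. power_slater z (hop n h S) J) =
      (\<Sum>h\<in>S. if can_hop n S h then power_slater z (hop n h S) J else 0)"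
    using fin by (intro sum.mono_neutral_cong_left) (auto simp: can_hop_def)
  also have "\<dots> = (\<Sum>b<d. if can_hop n S (elem S b) then power_slater z (hop n (elem S b) S) J else 0)"
    by (rule sum.reindex_bij_betw[symmetric, OF bij_betw_elem[OF fin S(2)]])
  also have "\<dots> = (\<Sum>b<d. alt_sum d (\<lambda>i j. z (elem J j) ^ ((elem S)(b := Suc (elem S b))) i))"
    by (intro sum.cong refl power_slater_increment[OF n S J z, symmetric]) auto
  also have "\<dots> = (\<Sum>j<d. z (elem J j)) * alt_sum d (\<lambda>i j. z (elem J j) ^ elem S i)"
    by (rule sum_alt_sum_increment)
  also have "(\<Sum>j<d. z (elem J j)) = (\<Sum>j\<in>J. z j)"
    by (rule sum.reindex_bij_betw[OF bij_betw_elem[OF J]])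
  finally show ?thesis by (simp add: power_slater_def slater_def S)
qed

section \<open>Counting closed walks of particles on a ring\<close>

fun reaches :: "nat \<Rightarrow> nat set \<Rightarrow> nat list \<Rightarrow> nat set \<Rightarrow> bool" where
  "reaches n S [] T \<longleftrightarrow> S = T"
| "reaches n S (h # w) T \<longleftrightarrow> can_hop n S h \<and> reaches n (hop n h S) w T"

text \<open>Walks are encoded by the sites from which the successive particles move.\<close>

definition walks :: "nat \<Rightarrow> nat \<Rightarrow> nat set \<Rightarrow> nat set \<Rightarrow> nat list set" where
  "walks n m S T = {w. length w = m \<and> reaches n S w T}"

lemma set_reaches: "reaches n S w T \<Longrightarrow> S \<subseteq> {..<n} \<Longrightarrow> set w \<subseteq> {..<n}"
proof (induction w arbitrary: S)
  case (Cons h w)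
  then have h: "can_hop n S h" by simp
  from Cons.IH[of "hop n h S"] Cons.prems hop_subset[OF h] have "set w \<subseteq> {..<n}" by simp
  with h Cons.prems show ?case by (auto simp: can_hop_def)
qed simp

lemma finite_walks:
  assumes "S \<subseteq> {..<n}"
  shows "finite (walks n m S T)"
proof (rule finite_subset)
  show "walks n m S T \<subseteq> {w. set w \<subseteq> {..<n} \<and> length w = m}"
    using set_reaches[OF _ assms] unfolding walks_def by blast
  show "finite {w. set w \<subseteq> {..<n} \<and> length w = m}"
    by (rule finite_lists_length_eq) simp
qed

lemma card_walks_Suc:
  assumes "S \<subseteq> {..<n}"
  shows "card (walks n (Suc m) S T) = (\<Sum>h | can_hop n S h. card (walks n m (hop n h S) T))"
proof -
  have fin: "finite {h. can_hop n S h}"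
    using assms by (auto simp: can_hop_def intro: finite_subset[of _ "{..<n}"])
  have "walks n (Suc m) S T = (\<Union>h\<in>{h. can_hop n S h}. (#) h ` walks n m (hop n h S) T)"
    by (auto simp: walks_def length_Suc_conv)
  also have "card \<dots> = (\<Sum>h | can_hop n S h. card ((#) h ` walks n m (hop n h S) T))"
    using fin finite_walks[OF hop_subset[OF _ assms]] by (intro card_UN_disjoint) auto
  finally show ?thesis by (simp add: card_image)
qed

lemma sum_walks_eigenfunction:
  fixes z :: "nat \<Rightarrow> complex"
  assumes n: "n \<ge> 2" and J: "finite J" "card J = d" and S: "S \<subseteq> {..<n}" "card S = d"
    and z: "\<And>j. j \<in> J \<Longrightarrow> z j ^ n = (-1) ^ (d - 1)"
  shows "(\<Sum>T | T \<subseteq> {..<n} \<and> card T = d. of_nat (card (walks n m S T)) * power_slater z T J) =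
         (\<Sum>j\<in>J. z j) ^ m * power_slater z S J"
  using S
proof (induction m arbitrary: S)
  case 0
  have "walks n 0 S T = (if S = T then {[]} else {})" for T by (auto simp: walks_def)
  then have "(\<Sum>T | T \<subseteq> {..<n} \<and> card T = d. of_nat (card (walks n 0 S T)) * power_slater z T J) =
     (\<Sum>T | T \<subseteq> {..<n} \<and> card T = d. if T = S then power_slater z S J else 0)"
    by (intro sum.cong refl) auto
  with 0 show ?case by (simp add: sum.delta)
next
  case (Suc m)
  have fin: "finite S" using Suc.prems by (auto intro: finite_subset)
  have "(\<Sum>T | T \<subseteq> {..<n} \<and> card T = d. of_nat (card (walks n (Suc m) S T)) * power_slater z T J) =
    (\<Sum>h | can_hop n S h. \<Sum>T | T \<subseteq> {..<n} \<and> card T = d. of_nat (card (walks n m (hop n h S) T)) * power_slater z T J)"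
    by (subst sum.swap) (simp add: card_walks_Suc Suc.prems sum_distrib_right)
  also have "\<dots> = (\<Sum>h | can_hop n S h. (\<Sum>j\<in>J. z j) ^ m * power_slater z (hop n h S) J)"
    using Suc.prems fin by (intro sum.cong refl Suc.IH) (simp_all add: card_hop hop_subset)
  also have "\<dots> = (\<Sum>j\<in>J. z j) ^ Suc m * power_slater z S J"
    using power_slater_eigenfunction[OF n Suc.prems J z] by (simp flip: sum_distrib_left)
  finally show ?case .
qed

definition unit_root :: "nat \<Rightarrow> nat \<Rightarrow> complex" where
  "unit_root n j = exp (2 * complex_of_real pi * \<i> * of_nat j / of_nat n)"

lemma unit_root_nonzero [simp]: "unit_root n j \<noteq> 0"
  unfolding unit_root_def by (rule exp_not_eq_zero)

lemma unit_root_power: "n \<noteq> 0 \<Longrightarrow> unit_root n j ^ n = 1"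
  unfolding unit_root_def by (rule complex_root_unity)

text \<open>Position and mode enter a root of unity symmetrically; this gives the orthogonality in the position
  from that in the mode.\<close>

lemma unit_root_power_swap: "unit_root n a ^ c = unit_root n c ^ a"
  unfolding unit_root_def exp_of_nat_mult[symmetric] by (rule arg_cong[of _ _ exp]) simp

lemma sum_unit_root_quotient_powers:
  assumes "a < n" "b < n"
  shows "(\<Sum>c<n. (unit_root n a / unit_root n b) ^ c) = (if a = b then of_nat n else 0)"
proof (cases "a = b")
  case True
  then show ?thesis by simp
next
  case False
  have n: "1 \<le> n" using assms by simp
  have "unit_root n a \<noteq> unit_root n b"
    unfolding unit_root_def complex_root_unity_eq[OF n] using assms False by simp
  moreover have "(unit_root n a / unit_root n b) ^ n = 1"
    using n by (simp add: power_divide unit_root_power)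
  ultimately show ?thesis using False by (simp add: sum_gp_strict)
qed

text \<open>A trace computed in the eigenbasis. The inverse of the matrix of eigenfunctions is, up to the factor \<open>n\<^sup>d\<close>,
  the matrix of the Slater determinants of the inverse momenta, because the momenta differ by
  \<open>n\<close>-th roots of unity.\<close>

theorem sum_closed_walks:
  fixes z :: "nat \<Rightarrow> complex"
  assumes n: "n \<ge> 2" and zeta: "\<zeta> ^ n = (-1) ^ (d - 1)"
    and z_def: "\<And>j. z j = \<zeta> * unit_root n j"
  shows "(\<Sum>S | S \<subseteq> {..<n} \<and> card S = d. of_nat (card (walks n m S S))) =
         (\<Sum>J | J \<subseteq> {..<n} \<and> card J = d. (\<Sum>j\<in>J. z j) ^ m)"
proof -
  define Cs where "Cs = {S. S \<subseteq> {..<n} \<and> card S = d}"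
  define g where "g s j = inverse (z j) ^ s" for s j
  have zeta0: "\<zeta> \<noteq> 0" using zeta n by (auto simp: power_0_left)
  have zn: "z j ^ n = (-1) ^ (d - 1)" for j
    using n zeta by (simp add: z_def power_mult_distrib unit_root_power)
  have orth_site: "(\<Sum>c<n. z c ^ a * g b c) = (if a = b then of_nat n else 0)" if "a < n" "b < n" for a b
  proof -
    have "z c ^ a * g b c = \<zeta> ^ a / \<zeta> ^ b * (unit_root n a / unit_root n b) ^ c" for c
      by (simp add: z_def g_def power_mult_distrib power_divide field_simps unit_root_power_swap[of n c] power_inverse)
    then have "(\<Sum>c<n. z c ^ a * g b c) = \<zeta> ^ a / \<zeta> ^ b * (\<Sum>c<n. (unit_root n a / unit_root n b) ^ c)"
      by (simp only: sum_distrib_left)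
    then show ?thesis using zeta0 by (simp add: sum_unit_root_quotient_powers[OF that])
  qed
  have orth_mode: "(\<Sum>c<n. z a ^ c * g c b) = (if a = b then of_nat n else 0)" if "a < n" "b < n" for a b
  proof -
    have "z a ^ c * g c b = (unit_root n a / unit_root n b) ^ c" for c
      using zeta0 by (simp add: z_def g_def power_mult_distrib power_divide field_simps power_inverse)
    then show ?thesis by (simp add: sum_unit_root_quotient_powers[OF that])
  qed
  \<comment> \<open>Orthogonality of the rows rewrites the Kronecker symbol in the trace, that of the columns evaluates the result.\<close>
  have rows: "(\<Sum>J\<in>Cs. power_slater z T J * slater g S J) = (if T = S then of_nat n ^ d else 0)"
    if "S \<in> Cs" "T \<in> Cs" for S T
    using that unfolding Cs_def power_slater_def
    by (intro slater_orthogonal orth_site) auto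
  have cols: "(\<Sum>S\<in>Cs. power_slater z S J * slater g S J) = of_nat n ^ d" if "J \<in> Cs" for J
  proof -
    have "(\<Sum>S\<in>Cs. power_slater z S J * slater g S J) =
        (\<Sum>S\<in>Cs. slater (\<lambda>j s. z j ^ s) J S * slater (\<lambda>j s. g s j) J S)"
      using that by (intro sum.cong refl) (auto simp: power_slater_def slater_swap[of _ J] Cs_def)
    also have "\<dots> = (if J = J then of_nat n ^ d else 0)"
      using that unfolding Cs_def by (intro slater_orthogonal orth_mode) auto
    finally show ?thesis by simp
  qed
  have "(of_nat n ^ d * (\<Sum>S\<in>Cs. of_nat (card (walks n m S S))) :: complex) =
      (\<Sum>S\<in>Cs. \<Sum>T\<in>Cs. of_nat (card (walks n m S T)) * (if T = S then of_nat n ^ d else 0))"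
  proof -
    have "finite Cs" unfolding Cs_def by (rule finite_subset[of _ "Pow {..<n}"]) auto
    then show ?thesis by (simp add: sum_distrib_left if_distrib cong: if_cong) (simp add: mult_ac)
  qed
  also have "\<dots> = (\<Sum>S\<in>Cs. \<Sum>T\<in>Cs. of_nat (card (walks n m S T)) * (\<Sum>J\<in>Cs. power_slater z T J * slater g S J))"
    by (intro sum.cong refl) (simp add: rows)
  also have "\<dots> = (\<Sum>S\<in>Cs. \<Sum>J\<in>Cs. (\<Sum>T\<in>Cs. of_nat (card (walks n m S T)) * power_slater z T J) * slater g S J)"
  proof (rule sum.cong[OF refl])
    fix S
    show "(\<Sum>T\<in>Cs. of_nat (card (walks n m S T)) * (\<Sum>J\<in>Cs. power_slater z T J * slater g S J)) =
        (\<Sum>J\<in>Cs. (\<Sum>T\<in>Cs. of_nat (card (walks n m S T)) * power_slater z T J) * slater g S J)"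
      unfolding sum_distrib_left by (subst sum.swap) (simp add: sum_distrib_right mult.assoc)
  qed
  also have "\<dots> = (\<Sum>S\<in>Cs. \<Sum>J\<in>Cs. ((\<Sum>j\<in>J. z j) ^ m * power_slater z S J) * slater g S J)"
  proof (intro sum.cong refl arg_cong2[where f="(*)"])
    fix S J assume "S \<in> Cs" "J \<in> Cs"
    then show "(\<Sum>T\<in>Cs. of_nat (card (walks n m S T)) * power_slater z T J) = (\<Sum>j\<in>J. z j) ^ m * power_slater z S J"
      unfolding Cs_def using zn
      by (intro sum_walks_eigenfunction[OF n]) (auto intro: finite_subset)
  qed
  also have "\<dots> = (\<Sum>J\<in>Cs. (\<Sum>j\<in>J. z j) ^ m * (\<Sum>S\<in>Cs. power_slater z S J * slater g S J))"
    by (subst sum.swap) (simp add: sum_distrib_left mult_ac)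
  also have "\<dots> = of_nat n ^ d * (\<Sum>J\<in>Cs. (\<Sum>j\<in>J. z j) ^ m)"
    unfolding sum_distrib_left[of "of_nat n ^ d"] by (intro sum.cong refl) (simp add: cols)
  finally show ?thesis using n unfolding Cs_def by simp
qed

section \<open>Volumes of sets determined by the order of the coordinates\<close>

text \<open>A ranking lists the order of the coordinates of a point: \<open>q a\<close> is the number of coordinates below the
  one with index \<open>a\<close>.\<close>

definition rankings :: "'i set \<Rightarrow> ('i \<Rightarrow> nat) set" where
  "rankings I = {q \<in> I \<rightarrow>\<^sub>E {..<card I}. bij_betw q I {..<card I}}"

definition chamber :: "'i set \<Rightarrow> ('i \<Rightarrow> nat) \<Rightarrow> ('i \<Rightarrow> real) set" where
  "chamber I q = {t \<in> I \<rightarrow>\<^sub>E {0..<1}. \<forall>a\<in>I. \<forall>b\<in>I. t a < t b \<longleftrightarrow> q a < q b}"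

lemma finite_rankings: "finite I \<Longrightarrow> finite (rankings I)"
  unfolding rankings_def by (simp add: finite_PiE)

lemma card_rankings:
  assumes "finite I"
  shows "card (rankings I) = fact (card I)"
proof -
  obtain e where "bij_betw e I {..<card I}"
    using assms ex_bij_betw_finite_nat[of I] by (auto simp: lessThan_atLeast0)
  from bij_betw_same_card[OF bij_betw_permutes_bijections[OF this]]
  show ?thesis using assms by (simp add: rankings_def card_permutations)
qed

lemma ranking_exists:
  fixes t :: "'i \<Rightarrow> real"
  assumes "finite I" "inj_on t I"
  obtains q where "q \<in> rankings I" "\<And>a b. a \<in> I \<Longrightarrow> b \<in> I \<Longrightarrow> t a < t b \<longleftrightarrow> q a < q b"
proof -
  define r where "r a = card {b \<in> I. t b < t a}" for a
  have mono: "r a < r b" if "a \<in> I" "t a < t b" for a b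
    unfolding r_def using that assms(1) by (intro psubset_card_mono) auto
  have iff: "t a < t b \<longleftrightarrow> r a < r b" if "a \<in> I" "b \<in> I" for a b
    using mono[of a b] mono[of b a] that assms(2) by (cases "t a" "t b" rule: linorder_cases) (auto dest: inj_onD)
  have less: "r a < card I" if "a \<in> I" for a
    unfolding r_def using that assms(1) by (intro psubset_card_mono) auto
  have "inj_on r I"
  proof (rule inj_onI)
    fix a b assume ab: "a \<in> I" "b \<in> I" "r a = r b"
    then have "t a = t b" using iff[of a b] iff[of b a] by simp
    then show "a = b" using ab assms(2) by (auto dest: inj_onD)
  qed
  moreover from this have "r ` I = {..<card I}"
    using less by (intro card_subset_eq) (auto simp: card_image)
  ultimately have "restrict r I \<in> rankings I"
    using less by (auto simp: rankings_def bij_betw_def)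
  with iff show thesis by (intro that[of "restrict r I"]) auto
qed

context
  fixes I :: "'i set"
  assumes finite_I: "finite I"
begin

abbreviation "lebI \<equiv> Pi\<^sub>M I (\<lambda>_. lborel :: real measure)"

interpretation product_sigma_finite "\<lambda>_ :: 'i. lborel :: real measure"
  by standard

lemma sets_chamber: "chamber I q \<in> sets lebI"
proof -
  have "chamber I q = {t \<in> space lebI. (\<forall>a\<in>I. 0 \<le> t a \<and> t a < 1) \<and>
      (\<forall>a\<in>I. \<forall>b\<in>I. t a < t b \<longleftrightarrow> q a < q b)}"
    by (auto simp: chamber_def space_PiM PiE_def Pi_def)
  also have "\<dots> \<in> sets lebI" using finite_I by measurable
  finally show ?thesis .
qed

lemma emeasure_unit_cube: "emeasure lebI (I \<rightarrow>\<^sub>E {0..<1}) = 1"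
  using finite_I by (subst emeasure_PiM) auto

text \<open>For fixed values of the other coordinates, a tie leaves a single value for the coordinate \<open>a\<close>.\<close>

lemma emeasure_tie:
  assumes "a \<in> I" "b \<in> I" "a \<noteq> b"
  shows "emeasure lebI {t \<in> space lebI. t a = t b} = 0"
proof -
  define K where "K = I - {a}"
  have I: "I = insert a K" and K: "finite K" "a \<notin> K" "b \<in> K"
    using assms finite_I by (auto simp: K_def)
  let ?A = "{t \<in> space lebI. t a = t b}"
  have A: "?A \<in> sets lebI" using assms by measurable
  have "emeasure lebI ?A = (\<integral>\<^sup>+ t. indicator ?A t \<partial>lebI)"
    using A by simp
  also have "\<dots> = (\<integral>\<^sup>+ x. (\<integral>\<^sup>+ y. indicator ?A (x(a := y)) \<partial>lborel) \<partial>Pi\<^sub>M K (\<lambda>_. lborel))"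
    unfolding I by (rule product_nn_integral_insert) (use K A I in auto)
  also have "\<dots> = (\<integral>\<^sup>+ x. 0 \<partial>Pi\<^sub>M K (\<lambda>_. lborel :: real measure))"
  proof (rule nn_integral_cong)
    fix x :: "'i \<Rightarrow> real" assume x: "x \<in> space (Pi\<^sub>M K (\<lambda>_. lborel))"
    have "(\<integral>\<^sup>+ y. indicator ?A (x(a := y)) \<partial>lborel) \<le> (\<integral>\<^sup>+ y. indicator {x b} y \<partial>lborel)"
      using K assms by (intro nn_integral_mono) (auto simp: indicator_def)
    then show "(\<integral>\<^sup>+ y. indicator ?A (x(a := y)) \<partial>lborel) = 0" by simp
  qed
  finally show ?thesis by simp
qed

lemma AE_inj_on: "AE t in lebI. inj_on t I"
proof -
  have "AE t in lebI. t a \<noteq> t b" if "a \<in> I" "b \<in> I" "a \<noteq> b" for a b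
  proof (rule AE_I)
    show "{t \<in> space lebI. \<not> t a \<noteq> t b} \<subseteq> {t \<in> space lebI. t a = t b}" by auto
    show "emeasure lebI {t \<in> space lebI. t a = t b} = 0" using that by (rule emeasure_tie)
    show "{t \<in> space lebI. t a = t b} \<in> sets lebI" using that by measurable
  qed
  then have "AE t in lebI. \<forall>a\<in>I. \<forall>b\<in>I. a \<noteq> b \<longrightarrow> t a \<noteq> t b"
    using finite_I by (intro AE_finite_allI) (auto intro: AE_impI)
  then show ?thesis by eventually_elim (auto simp: inj_on_def)
qed

text \<open>Permuting the coordinates maps boxes to boxes with the same side lengths, and boxes determine the
  product measure.\<close>

lemma distr_reindex:
  assumes f: "bij_betw f I I"
  shows "distr lebI lebI (\<lambda>t. \<lambda>a\<in>I. t (f a)) = lebI"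
proof (rule PiM_eqI[OF finite_I])
  have meas: "(\<lambda>t. \<lambda>a\<in>I. t (f a)) \<in> measurable lebI lebI"
    using f by (intro measurable_restrict measurable_component_singleton) (auto simp: bij_betw_def)
  fix A :: "'i \<Rightarrow> real set" assume A: "\<And>i. i \<in> I \<Longrightarrow> A i \<in> sets lborel"
  define g where "g = inv_into I f"
  have g: "bij_betw g I I" unfolding g_def using f by (rule bij_betw_inv_into)
  have fg: "f (g a) = a" "g (f a) = a" "f a \<in> I" "g a \<in> I" if "a \<in> I" for a
    using that f unfolding g_def
    by (auto simp: bij_betw_def f_inv_into_f inv_into_f_f inv_into_into)
  have "(\<lambda>t. \<lambda>a\<in>I. t (f a)) -` (Pi\<^sub>E I A) \<inter> space lebI = Pi\<^sub>E I (\<lambda>i. A (g i))"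
  proof (rule set_eqI)
    fix t
    have "(\<forall>b\<in>I. t b \<in> A (g b)) \<longleftrightarrow> (\<forall>b\<in>f ` I. t b \<in> A (g b))" using f by (simp add: bij_betw_def)
    also have "\<dots> \<longleftrightarrow> (\<forall>a\<in>I. t (f a) \<in> A a)" using fg(2) by simp
    finally show "t \<in> (\<lambda>t. \<lambda>a\<in>I. t (f a)) -` (Pi\<^sub>E I A) \<inter> space lebI \<longleftrightarrow> t \<in> Pi\<^sub>E I (\<lambda>i. A (g i))"
      by (auto simp: space_PiM PiE_iff)
  qed
  moreover have "Pi\<^sub>E I A \<in> sets lebI" using A finite_I by (intro sets_PiM_I_finite) auto
  ultimately have "emeasure (distr lebI lebI (\<lambda>t. \<lambda>a\<in>I. t (f a))) (Pi\<^sub>E I A) = emeasure lebI (Pi\<^sub>E I (\<lambda>i. A (g i)))"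
    using meas by (simp add: emeasure_distr)
  also have "\<dots> = (\<Prod>i\<in>I. emeasure lborel (A (g i)))"
    using A fg finite_I by (intro emeasure_PiM) auto
  also have "\<dots> = (\<Prod>i\<in>I. emeasure lborel (A i))"
    using g by (rule prod.reindex_bij_betw)
  finally show "emeasure (distr lebI lebI (\<lambda>t. \<lambda>a\<in>I. t (f a))) (Pi\<^sub>E I A) = (\<Prod>i\<in>I. emeasure lborel (A i))" .
qed simp

text \<open>The permutation of the coordinates that turns the ranking \<open>r\<close> into \<open>q\<close> maps one chamber onto the other.\<close>

lemma emeasure_chamber_eq:
  assumes q: "q \<in> rankings I" and r: "r \<in> rankings I"
  shows "emeasure lebI (chamber I q) = emeasure lebI (chamber I r)"
proof -
  define f where "f = inv_into I q \<circ> r"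
  have f: "bij_betw f I I" unfolding f_def
    using q r bij_betw_inv_into by (auto simp: rankings_def intro: bij_betw_trans)
  have qf: "q (f a) = r a" if "a \<in> I" for a
  proof -
    have "r a \<in> q ` I" using q r that by (auto simp: rankings_def bij_betw_def)
    then show ?thesis by (simp add: f_def f_inv_into_f)
  qed
  have all_f: "(\<forall>a\<in>I. R (f a)) \<longleftrightarrow> (\<forall>a\<in>I. R a)" for R
  proof -
    have "(\<forall>a\<in>I. R a) \<longleftrightarrow> (\<forall>a\<in>f ` I. R a)" using f by (simp add: bij_betw_def)
    then show ?thesis by simp
  qed
  have meas: "(\<lambda>t. \<lambda>a\<in>I. t (f a)) \<in> measurable lebI lebI"
    using f by (intro measurable_restrict measurable_component_singleton) (auto simp: bij_betw_def)
  have "(\<lambda>t. \<lambda>a\<in>I. t (f a)) -` chamber I r \<inter> space lebI = chamber I q" (is "?L = _")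
  proof (rule set_eqI)
    fix t
    have "t \<in> ?L \<longleftrightarrow> t \<in> extensional I \<and> (\<forall>a\<in>I. 0 \<le> t (f a) \<and> t (f a) < 1) \<and>
        (\<forall>a\<in>I. \<forall>b\<in>I. t (f a) < t (f b) \<longleftrightarrow> q (f a) < q (f b))"
      by (auto simp: chamber_def space_PiM PiE_iff qf)
    also have "\<dots> \<longleftrightarrow> t \<in> extensional I \<and> (\<forall>a\<in>I. 0 \<le> t a \<and> t a < 1) \<and>
        (\<forall>a\<in>I. \<forall>b\<in>I. t a < t b \<longleftrightarrow> q a < q b)"
      unfolding all_f[of "\<lambda>x. 0 \<le> t x \<and> t x < 1"] all_f[of "\<lambda>y. t _ < t y \<longleftrightarrow> q _ < q y"]
        all_f[of "\<lambda>x. \<forall>b\<in>I. t x < t b \<longleftrightarrow> q x < q b"] ..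
    also have "\<dots> \<longleftrightarrow> t \<in> chamber I q" by (auto simp: chamber_def PiE_iff)
    finally show "t \<in> ?L \<longleftrightarrow> t \<in> chamber I q" .
  qed
  then have "emeasure (distr lebI lebI (\<lambda>t. \<lambda>a\<in>I. t (f a))) (chamber I r) = emeasure lebI (chamber I q)"
    using meas sets_chamber by (simp add: emeasure_distr)
  then show ?thesis unfolding distr_reindex[OF f] by simp
qed

text \<open>The ranking can be read off from a point of the chamber, by counting smaller coordinates.\<close>

lemma disjoint_chambers: "disjoint_family_on (chamber I) (rankings I)"
proof (unfold disjoint_family_on_def, intro ballI impI equals0I)
  fix q r t assume q: "q \<in> rankings I" and r: "r \<in> rankings I" and "q \<noteq> r" and t: "t \<in> chamber I q \<inter> chamber I r"
  have card_below: "s a = card {b \<in> I. t b < t a}" if "s \<in> rankings I" "t \<in> chamber I s" "a \<in> I" for s a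
  proof -
    have s: "bij_betw s I {..<card I}" using that by (simp add: rankings_def)
    have "s ` {b \<in> I. s b < s a} = {..<s a}"
    proof -
      have im: "s ` I = {..<card I}" using s by (simp add: bij_betw_def)
      then have "s a < card I" using that(3) by auto
      have "v \<in> s ` {b \<in> I. s b < s a}" if "v < s a" for v
      proof -
        have "v \<in> s ` I" unfolding im using that \<open>s a < card I\<close> by simp
        with that show ?thesis by auto
      qed
      then show ?thesis by auto
    qed
    moreover have "inj_on s {b \<in> I. s b < s a}" using s by (auto simp: bij_betw_def inj_on_def)
    ultimately have "card {b \<in> I. s b < s a} = s a" by (metis card_image card_lessThan)
    moreover have "{b \<in> I. s b < s a} = {b \<in> I. t b < t a}" using that by (auto simp: chamber_def)
    ultimately show ?thesis by simp
  qed
  have "q = r"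
    using q r by (intro PiE_ext[of _ I "\<lambda>_. {..<card I}"]) (use t in \<open>auto simp: rankings_def card_below[OF q] card_below[OF r]\<close>)
  with \<open>q \<noteq> r\<close> show False by simp
qed

lemma emeasure_union_chambers:
  assumes A: "A \<in> sets lebI" "A \<subseteq> I \<rightarrow>\<^sub>E {0..<1}"
    and P: "\<And>q t. q \<in> rankings I \<Longrightarrow> t \<in> chamber I q \<Longrightarrow> t \<in> A \<longleftrightarrow> P q"
  shows "emeasure lebI A = (\<Sum>q | q \<in> rankings I \<and> P q. emeasure lebI (chamber I q))"
proof -
  let ?Q = "{q. q \<in> rankings I \<and> P q}"
  have "emeasure lebI A = emeasure lebI (\<Union>q\<in>?Q. chamber I q)"
  proof (rule emeasure_eq_AE)
    show "AE t in lebI. t \<in> A \<longleftrightarrow> t \<in> (\<Union>q\<in>?Q. chamber I q)"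
      using AE_inj_on
    proof eventually_elim
      case (elim t)
      show ?case
      proof
        assume "t \<in> A"
        obtain q where q: "q \<in> rankings I" "\<And>a b. a \<in> I \<Longrightarrow> b \<in> I \<Longrightarrow> t a < t b \<longleftrightarrow> q a < q b"
          using ranking_exists[OF finite_I elim] by blast
        then have "t \<in> chamber I q" using A \<open>t \<in> A\<close> by (auto simp: chamber_def)
        with q P \<open>t \<in> A\<close> show "t \<in> (\<Union>q\<in>?Q. chamber I q)" by blast
      qed (use P in blast)
    qed
    show "(\<Union>q\<in>?Q. chamber I q) \<in> sets lebI"
      using finite_rankings[OF finite_I] sets_chamber by (intro sets.finite_UN) auto
  qed (fact A)
  also have "\<dots> = (\<Sum>q\<in>?Q. emeasure lebI (chamber I q))"
    using finite_rankings[OF finite_I] sets_chamber disjoint_chambers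
    by (intro sum_emeasure[symmetric]) (auto simp: disjoint_family_on_def)
  finally show ?thesis .
qed

text \<open>Up to ties the cube is the disjoint union of the chambers, so each of these congruent sets has volume
  \<open>1 / (card I)!\<close>. A set that is a union of chambers up to ties has the volume of its chambers.\<close>

theorem measure_order_invariant:
  assumes A: "A \<in> sets lebI" "A \<subseteq> I \<rightarrow>\<^sub>E {0..<1}"
    and P: "\<And>q t. q \<in> rankings I \<Longrightarrow> t \<in> chamber I q \<Longrightarrow> t \<in> A \<longleftrightarrow> P q"
  shows "measure lebI A = card {q \<in> rankings I. P q} / fact (card I)"
proof -
  obtain q0 where q0: "q0 \<in> rankings I"
    using card_rankings[OF finite_I] by (metis card.empty ex_in_conv fact_nonzero)
  define v where "v = measure lebI (chamber I q0)"
  have "emeasure lebI (chamber I q0) \<le> emeasure lebI (I \<rightarrow>\<^sub>E {0..<1})"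
    using finite_I by (intro emeasure_mono sets_PiM_I_finite) (auto simp: chamber_def)
  then have "emeasure lebI (chamber I q0) = ennreal v"
    unfolding v_def by (intro emeasure_eq_ennreal_measure) (auto simp: emeasure_unit_cube top_unique)
  then have v: "emeasure lebI (chamber I q) = ennreal v" if "q \<in> rankings I" for q
    using emeasure_chamber_eq[OF that q0] by simp
  have v0: "v \<ge> 0" by (simp add: v_def)
  have "emeasure lebI (I \<rightarrow>\<^sub>E {0..<1}) = (\<Sum>q | q \<in> rankings I \<and> True. emeasure lebI (chamber I q))"
    using finite_I by (intro emeasure_union_chambers sets_PiM_I_finite) (auto simp: chamber_def)
  then have "1 = of_nat (fact (card I)) * ennreal v"
    using v by (simp add: emeasure_unit_cube card_rankings[OF finite_I])
  then have "1 = ennreal (fact (card I) * v)"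
    using v0 by (simp only: ennreal_of_nat_eq_real_of_nat of_nat_fact ennreal_mult fact_ge_zero)
  then have fact_v: "fact (card I) * v = 1"
    using v0 by (metis ennreal_eq_1)
  have "emeasure lebI A = (\<Sum>q | q \<in> rankings I \<and> P q. emeasure lebI (chamber I q))"
    by (rule emeasure_union_chambers[OF A P])
  also have "\<dots> = ennreal (card {q \<in> rankings I. P q} * v)"
    using v v0 by (simp add: ennreal_mult ennreal_of_nat_eq_real_of_nat)
  finally have "measure lebI A = card {q \<in> rankings I. P q} * v"
    using v0 by (intro measure_eq_emeasure_eq_ennreal) simp_all
  then show ?thesis using fact_v by (simp add: field_simps)
qed

end

section \<open>Arrays of bead configurations\<close>

text \<open>The conditions of a bead configuration and its occupation number in terms of the array alone. Only
  comparisons of entries occur, so real arrays and rankings can be treated alike.\<close>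

definition bead_pattern :: "nat \<Rightarrow> nat \<Rightarrow> nat \<Rightarrow> (nat \<times> nat \<Rightarrow> real) \<Rightarrow> bool" where
  "bead_pattern n k l t \<longleftrightarrow>
     (\<forall>h<n. interlace_le k (\<lambda>j. t (h, j)) (\<lambda>j. t ((h + 1) mod n, j)) \<or>
            interlace_less k (\<lambda>j. t (h, j)) (\<lambda>j. t ((h + 1) mod n, j))) \<and>
     card {h. h < n \<and> t (h, 1) < t ((h + n - 1) mod n, 1)} = l"

lemma interlace_cong:
  assumes "\<And>i j. i \<in> {1..k} \<Longrightarrow> j \<in> {1..k} \<Longrightarrow> t i < t' j \<longleftrightarrow> u i < u' j"
    "\<And>i j. i \<in> {1..k} \<Longrightarrow> j \<in> {1..k} \<Longrightarrow> t' i < t j \<longleftrightarrow> u' i < u j"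
  shows "interlace_le k t t' = interlace_le k u u'" "interlace_less k t t' = interlace_less k u u'"
  unfolding interlace_le_def interlace_less_def not_less[symmetric]
  by (intro arg_cong2[where f="(\<and>)"] ball_cong refl; simp add: assms)+

lemma bead_pattern_cong:
  assumes eq: "\<And>a b. a \<in> {..<n} \<times> {1..k} \<Longrightarrow> b \<in> {..<n} \<times> {1..k} \<Longrightarrow> t a < t b \<longleftrightarrow> u a < u b"
    and k: "k \<ge> 1"
  shows "bead_pattern n k l t = bead_pattern n k l u"
proof -
  have le: "interlace_le k (\<lambda>j. t (h, j)) (\<lambda>j. t ((h + 1) mod n, j)) =
      interlace_le k (\<lambda>j. u (h, j)) (\<lambda>j. u ((h + 1) mod n, j))"
    and less: "interlace_less k (\<lambda>j. t (h, j)) (\<lambda>j. t ((h + 1) mod n, j)) =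
      interlace_less k (\<lambda>j. u (h, j)) (\<lambda>j. u ((h + 1) mod n, j))" if "h < n" for h
    using that by (intro interlace_cong eq; simp)+
  have "{h. h < n \<and> t (h, 1) < t ((h + n - 1) mod n, 1)} = {h. h < n \<and> u (h, 1) < u ((h + n - 1) mod n, 1)}"
    using k by (intro Collect_cong conj_cong refl eq) auto
  then show ?thesis unfolding bead_pattern_def using le less by simp
qed

lemma bead_pattern_row_increasing:
  assumes "bead_pattern n k l t" "h < n"
  shows "strict_mono_on {..<k} (\<lambda>i. t (h, Suc i))"
proof (cases k)
  case (Suc m)
  have step: "t (h, Suc i) < t (h, Suc (Suc i))" if "Suc i < k" for i
  proof -
    have "interlace_le k (\<lambda>j. t (h, j)) (\<lambda>j. t ((h + 1) mod n, j)) \<or>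
            interlace_less k (\<lambda>j. t (h, j)) (\<lambda>j. t ((h + 1) mod n, j))"
      using assms by (simp add: bead_pattern_def)
    then show ?thesis
    proof
      assume "interlace_le k (\<lambda>j. t (h, j)) (\<lambda>j. t ((h + 1) mod n, j))"
      then have "t (h, Suc i) \<le> t ((h + 1) mod n, Suc i)" "t ((h + 1) mod n, Suc i) < t (h, Suc i + 1)"
        using that unfolding interlace_le_def by auto
      then show ?thesis by simp
    next
      assume "interlace_less k (\<lambda>j. t (h, j)) (\<lambda>j. t ((h + 1) mod n, j))"
      then have "t ((h + 1) mod n, Suc (Suc i)) < t (h, Suc (Suc i))" "t (h, Suc i) \<le> t ((h + 1) mod n, Suc i + 1)"
        using that unfolding interlace_less_def by auto
      then show ?thesis by simp
    qed
  qed
  have "t (h, Suc i) < t (h, Suc j)" if "i < j" "j < k" for i j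
    using that
  proof (induction j)
    case (Suc j)
    then show ?case using step[of j] by (cases "i = j") auto
  qed simp
  then show ?thesis by (auto simp: strict_mono_on_def)
qed (simp add: strict_mono_on_def)

text \<open>The conditions on the range and on the number of points of each string reduce to membership in the cube,
  because interlacing already makes the rows of the array increasing and hence their entries distinct.\<close>

lemma bead_array_image:
  assumes n: "n \<ge> 1" and k: "k \<ge> 1"
  shows "bead_array n k ` {X. bead_configuration n k X \<and> occupation_number n X = l} =
    {t \<in> ({..<n} \<times> {1..k}) \<rightarrow>\<^sub>E {0..<1}. bead_pattern n k l t}"
proof (intro equalityI subsetI)
  fix t assume "t \<in> bead_array n k ` {X. bead_configuration n k X \<and> occupation_number n X = l}"
  then obtain X where X: "bead_configuration n k X" "occupation_number n X = l" and t: "t = bead_array n k X"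
    by blast
  have fin: "finite (string_coords X h)" for h
  proof (rule finite_subset)
    show "string_coords X h \<subseteq> fst ` X" by (force simp: string_coords_def)
    show "finite (fst ` X)" using X(1) by (simp add: bead_configuration_def)
  qed
  have card: "card (string_coords X h) = k" if "h < n" for h
    using X(1) that by (simp add: bead_configuration_def)
  have range: "bead_coord X h j \<in> {0..<1}" if "h < n" "j \<in> {1..k}" for h j
  proof -
    have "sorted_list_of_set (string_coords X h) ! (j - 1) \<in> set (sorted_list_of_set (string_coords X h))"
      using that card by (intro nth_mem) auto
    then have "(bead_coord X h j, h) \<in> X" using fin by (simp add: bead_coord_def string_coords_def)
    then show ?thesis using X(1) by (auto simp: bead_configuration_def)
  qed
  have Min: "Min (string_coords X h) = bead_coord X h 1" if "h < n" for h
  proof -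
    have "string_coords X h \<noteq> {}" using card[OF that] k by auto
    then show ?thesis using fin by (simp add: bead_coord_def sorted_list_of_set_nonempty)
  qed
  have "bead_pattern n k l t = bead_pattern n k l (\<lambda>(h, j). bead_coord X h j)"
    unfolding t using k by (intro bead_pattern_cong) (auto simp: bead_array_def)
  also have "\<dots>"
  proof -
    have "{h. h < n \<and> bead_coord X h 1 < bead_coord X ((h + n - 1) mod n) 1} =
        {h. h < n \<and> Min (string_coords X h) < Min (string_coords X ((h + n - 1) mod n))}"
      using n by (intro Collect_cong conj_cong refl) (simp add: Min)
    then show ?thesis
      using X by (simp add: bead_pattern_def bead_configuration_def occupation_number_def)
  qed
  finally show "t \<in> {t \<in> ({..<n} \<times> {1..k}) \<rightarrow>\<^sub>E {0..<1}. bead_pattern n k l t}"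
    unfolding t bead_array_def using range by auto
next
  fix t assume t: "t \<in> {t \<in> ({..<n} \<times> {1..k}) \<rightarrow>\<^sub>E {0..<1}. bead_pattern n k l t}"
  \<comment> \<open>Row \<open>h\<close> is increasing, so sorting the coordinates of string \<open>h\<close> gives back that row.\<close>
  define X where "X = {(t (h, j), h) | h j. h < n \<and> j \<in> {1..k}}"
  have coords: "string_coords X h = (\<lambda>i. t (h, Suc i)) ` {..<k}" if "h < n" for h
  proof -
    have "{1..k} = Suc ` {..<k}" by (simp add: image_Suc_lessThan)
    then show ?thesis using that by (auto simp: string_coords_def X_def)
  qed
  have inc: "strict_mono_on {..<k} (\<lambda>i. t (h, Suc i))" if "h < n" for h
    using bead_pattern_row_increasing that t by blast
  have bead: "bead_coord X h j = t (h, j)" if "h < n" "j \<in> {1..k}" for h j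
    using that by (auto simp: bead_coord_def coords sorted_list_of_set_image[OF inc])
  have card: "card (string_coords X h) = k" if "h < n" for h
    using strict_mono_on_imp_inj_on[OF inc[OF that]] that by (simp add: coords card_image)
  have Min: "Min (string_coords X h) = bead_coord X h 1" if "h < n" for h
    using k that by (simp add: bead_coord_def sorted_list_of_set_nonempty coords lessThan_empty_iff)
  have "bead_pattern n k l t = bead_pattern n k l (\<lambda>(h, j). bead_coord X h j)"
    using k by (intro bead_pattern_cong) (auto simp: bead)
  then have pat: "bead_pattern n k l (\<lambda>(h, j). bead_coord X h j)" using t by simp
  have "X = (\<lambda>(h, j). (t (h, j), h)) ` ({..<n} \<times> {1..k})" by (auto simp: X_def image_iff)
  then have "finite X" by simp
  moreover have "X \<subseteq> {0..<1} \<times> {..<n}" using t by (auto simp: X_def PiE_iff)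
  ultimately have "bead_configuration n k X"
    using pat card by (simp add: bead_configuration_def bead_pattern_def)
  moreover have "occupation_number n X = l"
  proof -
    have "{h. h < n \<and> bead_coord X h 1 < bead_coord X ((h + n - 1) mod n) 1} =
        {h. h < n \<and> Min (string_coords X h) < Min (string_coords X ((h + n - 1) mod n))}"
      using n by (intro Collect_cong conj_cong refl) (simp add: Min)
    then show ?thesis using pat by (simp add: bead_pattern_def occupation_number_def)
  qed
  moreover have "t = bead_array n k X"
    using t by (auto simp: bead_array_def bead PiE_iff extensional_def restrict_def fun_eq_iff)
  ultimately show "t \<in> bead_array n k ` {X. bead_configuration n k X \<and> occupation_number n X = l}"
    by blast
qed

lemma sets_bead_pattern:
  assumes n: "n \<ge> 1" and k: "k \<ge> 1"
  shows "{t \<in> ({..<n} \<times> {1..k}) \<rightarrow>\<^sub>E {0..<1}. bead_pattern n k l t} \<in>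
    sets (Pi\<^sub>M ({..<n} \<times> {1..k}) (\<lambda>_. lborel))" (is "_ \<in> sets ?M")
proof -
  have less: "Measurable.pred ?M (\<lambda>t. t a < t b)"
    if "a \<in> {..<n} \<times> {1..k}" "b \<in> {..<n} \<times> {1..k}" for a b
    using that by measurable
  have le: "Measurable.pred ?M (\<lambda>t. t a \<le> t b)"
    if "a \<in> {..<n} \<times> {1..k}" "b \<in> {..<n} \<times> {1..k}" for a b
    unfolding not_less[symmetric] by (intro pred_intros_logic less that)
  have unit: "Measurable.pred ?M (\<lambda>t. 0 \<le> t a \<and> t a < 1)" if "a \<in> {..<n} \<times> {1..k}" for a
    using that by measurable
  have nbr: "(h + 1) mod n < n" "(h + n - 1) mod n < n" for h using n by simp_all
  have "{t \<in> ({..<n} \<times> {1..k}) \<rightarrow>\<^sub>E {0..<1}. bead_pattern n k l t} =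
    {t \<in> space ?M. (\<forall>a\<in>{..<n} \<times> {1..k}. 0 \<le> t a \<and> t a < 1) \<and>
     (\<forall>h\<in>{..<n}. ((\<forall>j\<in>{1..k}. t (h, j) \<le> t ((h + 1) mod n, j)) \<and> (\<forall>j\<in>{1..<k}. t ((h + 1) mod n, j) < t (h, j + 1))) \<or>
            ((\<forall>j\<in>{1..k}. t ((h + 1) mod n, j) < t (h, j)) \<and> (\<forall>j\<in>{1..<k}. t (h, j) \<le> t ((h + 1) mod n, j + 1)))) \<and>
     (\<exists>S\<in>{S. S \<subseteq> {..<n} \<and> card S = l}. \<forall>h\<in>{..<n}. h \<in> S \<longleftrightarrow> t (h, 1) < t ((h + n - 1) mod n, 1))}"
  proof -
    \<comment> \<open>A condition on a cardinality becomes a finite disjunction over the possible sets.\<close>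
    have "card {h. h < n \<and> P h} = l \<longleftrightarrow> (\<exists>S\<in>{S. S \<subseteq> {..<n} \<and> card S = l}. \<forall>h\<in>{..<n}. h \<in> S \<longleftrightarrow> P h)" for P
    proof
      assume "card {h. h < n \<and> P h} = l"
      then show "\<exists>S\<in>{S. S \<subseteq> {..<n} \<and> card S = l}. \<forall>h\<in>{..<n}. h \<in> S \<longleftrightarrow> P h"
        by (intro bexI[of _ "{h. h < n \<and> P h}"]) auto
    next
      assume "\<exists>S\<in>{S. S \<subseteq> {..<n} \<and> card S = l}. \<forall>h\<in>{..<n}. h \<in> S \<longleftrightarrow> P h"
      then obtain S where S: "S \<subseteq> {..<n}" "card S = l" "\<forall>h\<in>{..<n}. h \<in> S \<longleftrightarrow> P h" by blast
      then have "{h. h < n \<and> P h} = S" by blast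
      then show "card {h. h < n \<and> P h} = l" using S by simp
    qed
    then show ?thesis
      by (auto simp: bead_pattern_def interlace_le_def interlace_less_def space_PiM PiE_iff)
  qed
  also have "\<dots> \<in> sets ?M"
    using nbr k
    by (intro predE pred_intros_logic pred_intros_finite unit less le) (auto intro: finite_subset[of _ "Pow {..<n}"])
  finally show ?thesis .
qed

theorem bead_volume_eq_card:
  assumes n: "n \<ge> 1" and k: "k \<ge> 1"
  shows "bead_volume n k l =
    card {q \<in> rankings ({..<n} \<times> {1..k}). bead_pattern n k l (\<lambda>a. real (q a))} / fact (n * k)"
proof -
  have "measure (Pi\<^sub>M ({..<n} \<times> {1..k}) (\<lambda>_. lborel)) {t \<in> ({..<n} \<times> {1..k}) \<rightarrow>\<^sub>E {0..<1}. bead_pattern n k l t} =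
     card {q \<in> rankings ({..<n} \<times> {1..k}). bead_pattern n k l (\<lambda>a. real (q a))} / fact (card ({..<n} \<times> {1..k}))"
  proof (rule measure_order_invariant)
    fix q t assume "t \<in> chamber ({..<n} \<times> {1..k}) q"
    then have "t \<in> ({..<n} \<times> {1..k}) \<rightarrow>\<^sub>E {0..<1}" "bead_pattern n k l t = bead_pattern n k l (\<lambda>a. real (q a))"
      using k by (auto simp: chamber_def intro!: bead_pattern_cong)
    then show "t \<in> {t \<in> ({..<n} \<times> {1..k}) \<rightarrow>\<^sub>E {0..<1}. bead_pattern n k l t} \<longleftrightarrow> bead_pattern n k l (\<lambda>a. real (q a))"
      by simp
  qed (use sets_bead_pattern[OF n k] in auto)
  then show ?thesis
    unfolding bead_volume_def bead_array_image[OF n k] by (simp add: card_cartesian_product)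
qed

section \<open>Rankings of beads as closed walks\<close>

lemma Suc_mod_eq_iff: "h < n \<Longrightarrow> a < n \<Longrightarrow> Suc h mod n = Suc a mod n \<longleftrightarrow> h = a"
  by (auto simp: mod_Suc split: if_splits)

lemma Suc_mod_surj: "x < n \<Longrightarrow> \<exists>h<n. x = Suc h mod n"
proof (cases x)
  case 0
  assume "x < n"
  with 0 show ?thesis by (intro exI[of _ "n - 1"]) simp
next
  case (Suc y)
  assume "x < n"
  with Suc show ?thesis by (intro exI[of _ y]) simp
qed

lemma Suc_mod_neq: "n \<ge> 2 \<Longrightarrow> h < n \<Longrightarrow> Suc h mod n \<noteq> h"
  by (auto simp: mod_Suc)

text \<open>The number of particles at the site after \<open>h\<close>, when the moves \<open>w\<close> have been made from the
  configuration \<open>S\<close> without regard to exclusion: arrivals come from \<open>h\<close>, departures leave the site itself.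
  Indexing by the predecessor avoids a predecessor modulo \<open>n\<close>.\<close>

definition occupancy :: "nat \<Rightarrow> nat set \<Rightarrow> nat list \<Rightarrow> nat \<Rightarrow> int" where
  "occupancy n S w h = of_bool (Suc h mod n \<in> S) + int (count_list w h) - int (count_list w (Suc h mod n))"

lemma occupancy_Cons:
  assumes "can_hop n S a" "a < n" "h < n"
  shows "occupancy n S (a # w) h = occupancy n (hop n a S) w h"
  using assms Suc_mod_eq_iff[of h n a]
  by (auto simp: occupancy_def can_hop_def hop_def)

lemma occupancy_blocked:
  assumes "n \<ge> 2" "a < n" "\<not> can_hop n S a"
  shows "\<exists>h<n. occupancy n S [a] h \<notin> {0, 1}"
proof (cases "a \<in> S")
  case True
  then show ?thesis
    using assms Suc_mod_neq[of n a] by (intro exI[of _ a]) (auto simp: occupancy_def can_hop_def)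
next
  case False
  obtain h where "h < n" "a = Suc h mod n" using Suc_mod_surj[OF assms(2)] by blast
  then show ?thesis
    using assms False Suc_mod_neq[of n h] by (intro exI[of _ h]) (auto simp: occupancy_def)
qed

text \<open>A word is a walk exactly if particle numbers \<open>0\<close> and \<open>1\<close> are never violated: the first forbidden move
  would empty an empty site or fill an occupied one.\<close>

lemma reaches_iff_occupancy:
  assumes n: "n \<ge> 2" and "S \<subseteq> {..<n}" "set w \<subseteq> {..<n}"
  shows "reaches n S w T \<longleftrightarrow> T \<subseteq> {..<n} \<and> (\<forall>i\<le>length w. \<forall>h<n. occupancy n S (take i w) h \<in> {0, 1}) \<and>
    (\<forall>h<n. of_bool (Suc h mod n \<in> T) = occupancy n S w h)"
  using assms(2,3)
proof (induction w arbitrary: S)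
  case Nil
  have "S = T" if "T \<subseteq> {..<n}" "\<forall>h<n. (Suc h mod n \<in> T) = (Suc h mod n \<in> S)"
  proof (rule set_eqI)
    fix x show "x \<in> S \<longleftrightarrow> x \<in> T"
      using that Nil Suc_mod_surj[of x n] by (cases "x < n") auto
  qed
  then show ?case using Nil by (auto simp: occupancy_def)
next
  case (Cons a w)
  have a: "a < n" using Cons.prems by simp
  show ?case
  proof (cases "can_hop n S a")
    case True
    have "(\<forall>i\<le>length (a # w). \<forall>h<n. occupancy n S (take i (a # w)) h \<in> {0, 1}) \<longleftrightarrow>
        (\<forall>i\<le>length w. \<forall>h<n. occupancy n S (a # take i w) h \<in> {0, 1})" (is "?L \<longleftrightarrow> ?R")
    proof
      assume L: ?L
      show ?R
      proof (intro allI impI)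
        fix i h assume "i \<le> length w" "h < n"
        then show "occupancy n S (a # take i w) h \<in> {0, 1}" using L[rule_format, of "Suc i" h] by simp
      qed
    next
      assume R: ?R
      show ?L
      proof (intro allI impI)
        fix i h assume "i \<le> length (a # w)" "h < n"
        then show "occupancy n S (take i (a # w)) h \<in> {0, 1}"
          using R by (cases i) (auto simp: occupancy_def)
      qed
    qed
    then show ?thesis
      using Cons.IH[of "hop n a S"] Cons.prems hop_subset[OF True] True
      by (simp add: occupancy_Cons[OF True a])
  next
    case False
    obtain h where "h < n" "occupancy n S [a] h \<notin> {0, 1}"
      using occupancy_blocked[OF n a False] by blast
    then have "\<not> (\<forall>i\<le>length (a # w). \<forall>h<n. occupancy n S (take i (a # w)) h \<in> {0, 1})"
      by (intro notI) (drule spec[of _ 1], auto)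
    with False show ?thesis by auto
  qed
qed

text \<open>In a closed walk each site receives as many particles as it releases, so all sites release the same
  number, and this must be \<open>k\<close> as there are \<open>n k\<close> moves.\<close>

lemma closed_walks_eq:
  assumes n: "n \<ge> 2" and S: "S \<subseteq> {..<n}"
  shows "walks n (n * k) S S = {w. length w = n * k \<and> set w \<subseteq> {..<n} \<and> (\<forall>h<n. count_list w h = k) \<and>
    (\<forall>i\<le>n * k. \<forall>h<n. occupancy n S (take i w) h \<in> {0, 1})}"
proof (intro set_eqI iffI)
  fix w assume w: "w \<in> walks n (n * k) S S"
  then have len: "length w = n * k" and r: "reaches n S w S" by (auto simp: walks_def)
  have set: "set w \<subseteq> {..<n}" using set_reaches[OF r S] .
  have occ: "\<forall>i\<le>n * k. \<forall>h<n. occupancy n S (take i w) h \<in> {0, 1}"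
    and final: "\<forall>h<n. of_bool (Suc h mod n \<in> S) = occupancy n S w h"
    using r reaches_iff_occupancy[OF n S set] len by auto
  have step: "count_list w (Suc h) = count_list w h" if "Suc h < n" for h
    using final[rule_format, of h] that by (simp add: occupancy_def)
  have const: "count_list w h = count_list w 0" if "h < n" for h
    using that by (induction h) (auto simp: step)
  have "n * k = (\<Sum>h<n. count_list w h)"
    using sum_count_set[OF set] len by simp
  also have "\<dots> = (\<Sum>h<n. count_list w 0)" by (rule sum.cong) (auto intro: const)
  also have "\<dots> = n * count_list w 0" by simp
  finally have "count_list w 0 = k" using n by simp
  then have "count_list w h = k" if "h < n" for h using const[OF that] by simp
  then show "w \<in> {w. length w = n * k \<and> set w \<subseteq> {..<n} \<and> (\<forall>h<n. count_list w h = k) \<and>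
    (\<forall>i\<le>n * k. \<forall>h<n. occupancy n S (take i w) h \<in> {0, 1})}"
    using len set occ by simp
next
  fix w assume "w \<in> {w. length w = n * k \<and> set w \<subseteq> {..<n} \<and> (\<forall>h<n. count_list w h = k) \<and>
    (\<forall>i\<le>n * k. \<forall>h<n. occupancy n S (take i w) h \<in> {0, 1})}"
  then have w: "length w = n * k" "set w \<subseteq> {..<n}" "\<forall>h<n. count_list w h = k"
    "\<forall>i\<le>n * k. \<forall>h<n. occupancy n S (take i w) h \<in> {0, 1}" by auto
  have "Suc h mod n < n" for h using n by simp
  then have "\<forall>h<n. of_bool (Suc h mod n \<in> S) = occupancy n S w h"
    using w(3) by (simp add: occupancy_def)
  then show "w \<in> walks n (n * k) S S"
    using reaches_iff_occupancy[OF n S w(2)] S w by (auto simp: walks_def)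
qed

definition num_below :: "nat \<Rightarrow> (nat \<Rightarrow> nat) \<Rightarrow> nat \<Rightarrow> nat" where
  "num_below k a i = card {j \<in> {1..k}. a j < i}"

text \<open>The counting function of an increasing sequence determines the sequence.\<close>

lemma le_num_below_iff:
  assumes a: "strict_mono_on {1..k} a" and j: "j \<in> {1..k}"
  shows "j \<le> num_below k a i \<longleftrightarrow> a j < i"
proof
  assume less: "a j < i"
  have "a j' < i" if "j' \<in> {1..j}" for j'
    using strict_mono_on_leD[OF a, of j' j] that j less by auto
  then have "{1..j} \<subseteq> {j \<in> {1..k}. a j < i}" using j by auto
  from card_mono[OF _ this] show "j \<le> num_below k a i" by (simp add: num_below_def)
next
  assume le: "j \<le> num_below k a i"
  show "a j < i"
  proof (rule ccontr)
    assume ge: "\<not> a j < i"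
    have "{j \<in> {1..k}. a j < i} \<subseteq> {1..<j}"
    proof
      fix j' assume j': "j' \<in> {j \<in> {1..k}. a j < i}"
      have "\<not> j \<le> j'"
        using strict_mono_on_leD[OF a, of j j'] j j' ge by auto
      with j' show "j' \<in> {1..<j}" by simp
    qed
    then have "num_below k a i \<le> card {1..<j}"
      unfolding num_below_def by (rule card_mono[rotated]) simp
    with le j show False by auto
  qed
qed

text \<open>Interlacing says that the two sequences alternate, starting with \<open>a\<close>: at any time \<open>a\<close> leads by none or
  one. Times up to \<open>m\<close> suffice, since the condition is only ever tested just after an entry.\<close>

lemma interlace_le_iff_num_below:
  assumes a: "strict_mono_on {1..k} a" and b: "strict_mono_on {1..k} b"
    and ne: "\<And>i j. i \<in> {1..k} \<Longrightarrow> j \<in> {1..k} \<Longrightarrow> a i \<noteq> b j"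
    and m: "\<And>j. j \<in> {1..k} \<Longrightarrow> a j < m \<and> b j < m"
  shows "interlace_le k (\<lambda>j. real (a j)) (\<lambda>j. real (b j)) \<longleftrightarrow>
    (\<forall>i\<le>m. num_below k b i \<le> num_below k a i \<and> num_below k a i \<le> Suc (num_below k b i))"
proof
  assume L: "interlace_le k (\<lambda>j. real (a j)) (\<lambda>j. real (b j))"
  have ab: "a j \<le> b j" if "j \<in> {1..k}" for j
    using that L by (auto simp: interlace_le_def)
  have ba: "b j < a (Suc j)" if "j \<in> {1..<k}" for j
    using that L by (auto simp: interlace_le_def)
  show "\<forall>i\<le>m. num_below k b i \<le> num_below k a i \<and> num_below k a i \<le> Suc (num_below k b i)"
  proof (intro allI impI conjI)
    fix i
    show "num_below k b i \<le> num_below k a i"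
      unfolding num_below_def using ab by (intro card_mono) (auto intro: le_less_trans)
    have "{j \<in> {1..k}. a j < i} \<subseteq> insert 1 (Suc ` {j \<in> {1..k}. b j < i})"
    proof
      fix j assume j: "j \<in> {j \<in> {1..k}. a j < i}"
      show "j \<in> insert 1 (Suc ` {j \<in> {1..k}. b j < i})"
      proof (cases "j = 1")
        case False
        with j obtain j' where "j = Suc j'" "j' \<in> {1..<k}" by (cases j) auto
        with j ba[of j'] show ?thesis by auto
      qed simp
    qed
    then have "num_below k a i \<le> card (insert 1 (Suc ` {j \<in> {1..k}. b j < i}))"
      unfolding num_below_def by (intro card_mono) auto
    also have "\<dots> \<le> Suc (num_below k b i)"
      unfolding num_below_def by (auto simp: card_insert_if card_image)
    finally show "num_below k a i \<le> Suc (num_below k b i)" .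
  qed
next
  assume R: "\<forall>i\<le>m. num_below k b i \<le> num_below k a i \<and> num_below k a i \<le> Suc (num_below k b i)"
  have "a j \<le> b j" if j: "j \<in> {1..k}" for j
  proof -
    have "j \<le> num_below k b (Suc (b j))" using le_num_below_iff[OF b j] by simp
    also have "\<dots> \<le> num_below k a (Suc (b j))" using R m[OF j] by simp
    finally show ?thesis using le_num_below_iff[OF a j] by simp
  qed
  moreover have "b j < a (Suc j)" if j: "j \<in> {1..<k}" for j
  proof -
    have jk: "j \<in> {1..k}" "Suc j \<in> {1..k}" using j by auto
    have "Suc j \<le> num_below k a (Suc (a (Suc j)))" using le_num_below_iff[OF a jk(2)] by simp
    also have "\<dots> \<le> Suc (num_below k b (Suc (a (Suc j))))" using R m[OF jk(2)] by simp
    finally have "b j < Suc (a (Suc j))" using le_num_below_iff[OF b jk(1)] by simp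
    with ne[OF jk(2,1)] show ?thesis by simp
  qed
  ultimately show "interlace_le k (\<lambda>j. real (a j)) (\<lambda>j. real (b j))"
    by (simp add: interlace_le_def)
qed

lemma interlace_less_iff_le:
  assumes "\<And>i j. i \<in> {1..k} \<Longrightarrow> j \<in> {1..k} \<Longrightarrow> t i \<noteq> t' j"
  shows "interlace_less k t t' \<longleftrightarrow> interlace_le k t' t"
proof -
  have 1: "t' j < t j \<longleftrightarrow> t' j \<le> t j" if "j \<in> {1..k}" for j
    using assms[of j j] that by auto
  have 2: "t j \<le> t' (j + 1) \<longleftrightarrow> t j < t' (j + 1)" if "j \<in> {1..<k}" for j
    using assms[of j "j + 1"] that by auto
  show ?thesis
    unfolding interlace_less_def interlace_le_def using 1 2 by blast
qed

context
  fixes n k :: nat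
  assumes n: "n \<ge> 2" and k: "k \<ge> 1"
begin

abbreviation "beads \<equiv> {..<n} \<times> {1..k}"

text \<open>The alternative in the definition of bead configurations that holds for the strings \<open>h\<close> and \<open>h + 1\<close> is the
  one in which string \<open>h + 1\<close> comes first exactly if site \<open>h + 1\<close> is occupied.\<close>

definition follows :: "nat set \<Rightarrow> (nat \<times> nat \<Rightarrow> nat) \<Rightarrow> bool" where
  "follows S q \<longleftrightarrow> (\<forall>h<n. if Suc h mod n \<in> S
     then interlace_less k (\<lambda>j. real (q (h, j))) (\<lambda>j. real (q (Suc h mod n, j)))
     else interlace_le k (\<lambda>j. real (q (h, j))) (\<lambda>j. real (q (Suc h mod n, j))))"

lemma ranking_surj: "q \<in> rankings beads \<Longrightarrow> q ` beads = {..<n * k}"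
  by (simp add: rankings_def bij_betw_def card_cartesian_product)

lemma ranking_inj_on: "q \<in> rankings beads \<Longrightarrow> inj_on q beads"
  by (simp add: rankings_def bij_betw_def)

lemma ranking_less: "q \<in> rankings beads \<Longrightarrow> a \<in> beads \<Longrightarrow> q a < n * k"
  using ranking_surj by blast

text \<open>Since ranks are distinct, the first beads of two neighbouring strings decide between the two
  alternatives, so the set of initially occupied sites is determined by the ranking.\<close>

lemma bead_pattern_iff_follows:
  assumes q: "q \<in> rankings beads"
  shows "bead_pattern n k l (\<lambda>a. real (q a)) \<longleftrightarrow> (\<exists>S\<subseteq>{..<n}. card S = l \<and> follows S q)"
    and "S \<subseteq> {..<n} \<Longrightarrow> follows S q \<Longrightarrow> S = {h. h < n \<and> q (h, 1) < q ((h + n - 1) mod n, 1)}"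
proof -
  define D where "D = {h. h < n \<and> q (h, 1) < q ((h + n - 1) mod n, 1)}"
  have pred: "(Suc h mod n + n - 1) mod n = h" if "h < n" for h
    using that n by (auto simp: mod_Suc)
  have Suc_lt: "Suc h mod n < n" for h using n by simp
  have D_iff: "Suc h mod n \<in> D \<longleftrightarrow> q (Suc h mod n, 1) < q (h, 1)" if "h < n" for h
    using pred[OF that] Suc_lt by (simp add: D_def)
  have le: "Suc h mod n \<notin> D"
    if "h < n" "interlace_le k (\<lambda>j. real (q (h, j))) (\<lambda>j. real (q (Suc h mod n, j)))" for h
  proof -
    have "q (h, 1) \<le> q (Suc h mod n, 1)" using that(2) k by (simp add: interlace_le_def)
    then show ?thesis using D_iff[OF that(1)] by simp
  qed
  have less: "Suc h mod n \<in> D"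
    if "h < n" "interlace_less k (\<lambda>j. real (q (h, j))) (\<lambda>j. real (q (Suc h mod n, j)))" for h
  proof -
    have "q (Suc h mod n, 1) < q (h, 1)" using that(2) k by (simp add: interlace_less_def)
    then show ?thesis using D_iff[OF that(1)] by simp
  qed
  show eq: "S = {h. h < n \<and> q (h, 1) < q ((h + n - 1) mod n, 1)}" if S: "S \<subseteq> {..<n}" "follows S q" for S
    unfolding D_def[symmetric]
  proof (rule set_eqI)
    fix x
    show "x \<in> S \<longleftrightarrow> x \<in> D"
    proof (cases "x < n")
      case True
      then obtain h where h: "h < n" "x = Suc h mod n" using Suc_mod_surj by blast
      with S(2) le[of h] less[of h] show ?thesis by (auto simp: follows_def split: if_splits)
    next
      case False
      with S show ?thesis by (auto simp: D_def)
    qed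
  qed
  have "follows D q" if "bead_pattern n k l (\<lambda>a. real (q a))"
    using that le less by (auto simp: follows_def bead_pattern_def)
  moreover have "card D = l" if "bead_pattern n k l (\<lambda>a. real (q a))"
    using that by (simp add: bead_pattern_def D_def)
  moreover have "D \<subseteq> {..<n}" by (auto simp: D_def)
  moreover have "bead_pattern n k l (\<lambda>a. real (q a))" if "S \<subseteq> {..<n}" "card S = l" "follows S q" for S
  proof -
    have "\<forall>h<n. interlace_le k (\<lambda>j. real (q (h, j))) (\<lambda>j. real (q (Suc h mod n, j))) \<or>
        interlace_less k (\<lambda>j. real (q (h, j))) (\<lambda>j. real (q (Suc h mod n, j)))"
      using that(3) by (auto simp: follows_def split: if_splits)
    then show ?thesis using that(2) eq[OF that(1,3)] by (simp add: bead_pattern_def)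
  qed
  ultimately show "bead_pattern n k l (\<lambda>a. real (q a)) \<longleftrightarrow> (\<exists>S\<subseteq>{..<n}. card S = l \<and> follows S q)"
    by blast
qed

lemma follows_rows_increasing:
  assumes "q \<in> rankings beads" "S \<subseteq> {..<n}" "follows S q" "h < n"
  shows "strict_mono_on {1..k} (\<lambda>j. q (h, j))"
proof -
  have "bead_pattern n k (card S) (\<lambda>a. real (q a))"
    using bead_pattern_iff_follows(1)[OF assms(1)] assms(2,3) by blast
  then have inc: "strict_mono_on {..<k} (\<lambda>i. real (q (h, Suc i)))"
    using assms(4) by (rule bead_pattern_row_increasing)
  show ?thesis
  proof (rule strict_mono_onI)
    fix i j assume "i \<in> {1..k}" "j \<in> {1..k}" "i < j"
    then show "q (h, i) < q (h, j)"
      using strict_mono_onD[OF inc, of "i - 1" "j - 1"] by simp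
  qed
qed

lemma follows_iff_num_below:
  assumes q: "q \<in> rankings beads" and inc: "\<And>h. h < n \<Longrightarrow> strict_mono_on {1..k} (\<lambda>j. q (h, j))"
  shows "follows S q \<longleftrightarrow> (\<forall>i\<le>n * k. \<forall>h<n.
    of_bool (Suc h mod n \<in> S) + int (num_below k (\<lambda>j. q (h, j)) i) - int (num_below k (\<lambda>j. q (Suc h mod n, j)) i) \<in> {0, 1})"
proof -
  have occupied_iff: "of_bool b + int x - int y \<in> {0, 1} \<longleftrightarrow>
      (if b then x \<le> y \<and> y \<le> Suc x else y \<le> x \<and> x \<le> Suc y)" for b x y
    by (cases b) auto
  have "(if Suc h mod n \<in> S
     then interlace_less k (\<lambda>j. real (q (h, j))) (\<lambda>j. real (q (Suc h mod n, j)))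
     else interlace_le k (\<lambda>j. real (q (h, j))) (\<lambda>j. real (q (Suc h mod n, j)))) \<longleftrightarrow> (\<forall>i\<le>n * k.
    of_bool (Suc h mod n \<in> S) + int (num_below k (\<lambda>j. q (h, j)) i) - int (num_below k (\<lambda>j. q (Suc h mod n, j)) i) \<in> {0, 1})"
    if h: "h < n" for h
  proof -
    have h': "Suc h mod n < n" "Suc h mod n \<noteq> h" using Suc_mod_neq[OF n h] n by auto
    have ne: "q (h, i) \<noteq> q (Suc h mod n, j)" if "i \<in> {1..k}" "j \<in> {1..k}" for i j
      using inj_on_eq_iff[OF ranking_inj_on[OF q], of "(h, i)" "(Suc h mod n, j)"] h h' that by simp
    have m: "q (h, j) < n * k \<and> q (Suc h mod n, j) < n * k" if "j \<in> {1..k}" for j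
      using ranking_less[OF q] h h' that by simp
    have less: "interlace_less k (\<lambda>j. real (q (h, j))) (\<lambda>j. real (q (Suc h mod n, j))) \<longleftrightarrow>
        interlace_le k (\<lambda>j. real (q (Suc h mod n, j))) (\<lambda>j. real (q (h, j)))"
      using ne by (intro interlace_less_iff_le) auto
    have "interlace_le k (\<lambda>j. real (q (h, j))) (\<lambda>j. real (q (Suc h mod n, j))) \<longleftrightarrow>
       (\<forall>i\<le>n * k. num_below k (\<lambda>j. q (Suc h mod n, j)) i \<le> num_below k (\<lambda>j. q (h, j)) i \<and>
         num_below k (\<lambda>j. q (h, j)) i \<le> Suc (num_below k (\<lambda>j. q (Suc h mod n, j)) i))"
      using ne m by (intro interlace_le_iff_num_below inc h h') auto
    moreover have "interlace_le k (\<lambda>j. real (q (Suc h mod n, j))) (\<lambda>j. real (q (h, j))) \<longleftrightarrow>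
       (\<forall>i\<le>n * k. num_below k (\<lambda>j. q (h, j)) i \<le> num_below k (\<lambda>j. q (Suc h mod n, j)) i \<and>
         num_below k (\<lambda>j. q (Suc h mod n, j)) i \<le> Suc (num_below k (\<lambda>j. q (h, j)) i))"
      using ne[symmetric] m by (intro interlace_le_iff_num_below inc h h') auto
    ultimately show ?thesis unfolding less occupied_iff by simp
  qed
  then show ?thesis unfolding follows_def by blast
qed

text \<open>The strings of the beads, in the order of their ranks.\<close>

definition word_of :: "(nat \<times> nat \<Rightarrow> nat) \<Rightarrow> nat list" where
  "word_of q = map (\<lambda>i. fst (inv_into beads q i)) [0..<n * k]"

lemma length_word_of [simp]: "length (word_of q) = n * k"
  by (simp add: word_of_def)

lemma word_of_nth:
  assumes q: "q \<in> rankings beads" and "h < n" "j \<in> {1..k}"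
  shows "word_of q ! q (h, j) = h"
proof -
  show ?thesis
    using assms ranking_less[OF q, of "(h, j)"] inv_into_f_f[OF ranking_inj_on[OF q], of "(h, j)"] by (simp add: word_of_def)
qed

lemma set_word_of:
  assumes "q \<in> rankings beads"
  shows "set (word_of q) \<subseteq> {..<n}"
proof -
  have "inv_into beads q i \<in> beads" if "i < n * k" for i
    using that by (intro inv_into_into) (simp only: ranking_surj[OF assms] lessThan_iff)
  then have "fst (inv_into beads q i) \<in> {..<n}" if "i < n * k" for i
    using that by (auto simp: mem_Times_iff)
  then show ?thesis by (auto simp: word_of_def)
qed

lemma count_list_take:
  assumes "i \<le> length w"
  shows "count_list (take i w) h = card {p. p < i \<and> w ! p = h}"
proof -
  have "{p. p < length (take i w) \<and> take i w ! p = h} = {p. p < i \<and> w ! p = h}"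
    using assms by auto
  then show ?thesis
    by (simp add: count_list_eq_length_filter length_filter_conv_card eq_commute)
qed

lemma count_list_word_of:
  assumes q: "q \<in> rankings beads" and h: "h < n" and i: "i \<le> n * k"
  shows "count_list (take i (word_of q)) h = num_below k (\<lambda>j. q (h, j)) i"
proof -
  have "{p. p < i \<and> word_of q ! p = h} = (\<lambda>j. q (h, j)) ` {j \<in> {1..k}. q (h, j) < i}"
  proof (intro set_eqI iffI)
    fix p assume p: "p \<in> {p. p < i \<and> word_of q ! p = h}"
    then have "p \<in> q ` beads" using ranking_surj[OF q] i by simp
    then obtain h' j where "p = q (h', j)" "h' < n" "j \<in> {1..k}" by auto
    with p word_of_nth[OF q, of h' j] show "p \<in> (\<lambda>j. q (h, j)) ` {j \<in> {1..k}. q (h, j) < i}" by auto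
  next
    fix p assume "p \<in> (\<lambda>j. q (h, j)) ` {j \<in> {1..k}. q (h, j) < i}"
    then show "p \<in> {p. p < i \<and> word_of q ! p = h}" using word_of_nth[OF q h] by auto
  qed
  moreover have "inj_on (\<lambda>j. q (h, j)) {j \<in> {1..k}. q (h, j) < i}"
  proof (rule inj_onI)
    fix j j' assume "j \<in> {j \<in> {1..k}. q (h, j) < i}" "j' \<in> {j \<in> {1..k}. q (h, j) < i}" "q (h, j) = q (h, j')"
    then show "j = j'" using inj_onD[OF ranking_inj_on[OF q], of "(h, j)" "(h, j')"] h by simp
  qed
  ultimately show ?thesis
    using i by (simp add: count_list_take card_image num_below_def)
qed

lemma follows_iff_occupancy:
  assumes q: "q \<in> rankings beads" and inc: "\<And>h. h < n \<Longrightarrow> strict_mono_on {1..k} (\<lambda>j. q (h, j))"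
  shows "follows S q \<longleftrightarrow> (\<forall>i\<le>n * k. \<forall>h<n. occupancy n S (take i (word_of q)) h \<in> {0, 1})"
proof -
  have Suc_lt: "Suc h mod n < n" for h using n by simp
  have "occupancy n S (take i (word_of q)) h = of_bool (Suc h mod n \<in> S) +
      int (num_below k (\<lambda>j. q (h, j)) i) - int (num_below k (\<lambda>j. q (Suc h mod n, j)) i)"
    if "i \<le> n * k" "h < n" for i h
    using that Suc_lt by (simp add: occupancy_def count_list_word_of[OF q])
  note occ = this
  have "follows S q \<longleftrightarrow> (\<forall>i\<le>n * k. \<forall>h<n. of_bool (Suc h mod n \<in> S) +
      int (num_below k (\<lambda>j. q (h, j)) i) - int (num_below k (\<lambda>j. q (Suc h mod n, j)) i) \<in> {0, 1})"
    by (rule follows_iff_num_below[OF q]) (rule inc)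
  also have "\<dots> \<longleftrightarrow> (\<forall>i\<le>n * k. \<forall>h<n. occupancy n S (take i (word_of q)) h \<in> {0, 1})"
    by (intro all_cong1 imp_cong refl) (simp only: occ)
  finally show ?thesis .
qed

text \<open>The word determines how many beads of a string have rank below \<open>i\<close>, and this determines an increasing row.\<close>

lemma word_of_inj:
  assumes q: "q \<in> rankings beads" "\<And>h. h < n \<Longrightarrow> strict_mono_on {1..k} (\<lambda>j. q (h, j))"
    and r: "r \<in> rankings beads" "\<And>h. h < n \<Longrightarrow> strict_mono_on {1..k} (\<lambda>j. r (h, j))"
    and eq: "word_of q = word_of r"
  shows "q = r"
proof (rule PiE_ext)
  show "q \<in> beads \<rightarrow>\<^sub>E {..<card beads}" "r \<in> beads \<rightarrow>\<^sub>E {..<card beads}"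
    using q(1) r(1) by (simp_all add: rankings_def)
  fix a assume "a \<in> beads"
  then obtain h j where a: "a = (h, j)" "h < n" "j \<in> {1..k}" by auto
  have "q a < i \<longleftrightarrow> r a < i" if "i \<le> n * k" for i
    using le_num_below_iff[OF q(2)[OF a(2)] a(3), of i] le_num_below_iff[OF r(2)[OF a(2)] a(3), of i]
      count_list_word_of[OF q(1) a(2) that] count_list_word_of[OF r(1) a(2) that] eq a(1) by simp
  from this[of "q a"] this[of "r a"] show "q a = r a"
    using ranking_less[OF q(1) \<open>a \<in> beads\<close>] ranking_less[OF r(1) \<open>a \<in> beads\<close>] by simp
qed

text \<open>The rank of the \<open>j\<close>-th bead of string \<open>h\<close> is the position of the \<open>j\<close>-th letter \<open>h\<close> in the word.\<close>

lemma word_of_surj: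
  assumes len: "length w = n * k" and set: "set w \<subseteq> {..<n}" and cnt: "\<And>h. h < n \<Longrightarrow> count_list w h = k"
  obtains q where "q \<in> rankings beads" "\<And>h. h < n \<Longrightarrow> strict_mono_on {1..k} (\<lambda>j. q (h, j))" "word_of q = w"
proof -
  define P where "P h = {p. p < n * k \<and> w ! p = h}" for h
  have finP: "finite (P h)" for h by (simp add: P_def)
  have cardP: "card (P h) = k" if "h < n" for h
    using count_list_take[of "n * k" w h] cnt[OF that] len by (simp add: P_def)
  define q where "q = (\<lambda>(h, j)\<in>beads. elem (P h) (j - 1))"
  have q: "q (h, j) = elem (P h) (j - 1)" if "h < n" "j \<in> {1..k}" for h j
    using that by (simp add: q_def)
  have inc: "strict_mono_on {1..k} (\<lambda>j. q (h, j))" if "h < n" for h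
  proof (rule strict_mono_onI)
    fix i j assume ij: "i \<in> {1..k}" "j \<in> {1..k}" "i < j"
    have "elem (P h) (i - 1) < elem (P h) (j - 1)"
      using ij cardP[OF that] by (intro elem_less) auto
    then show "q (h, i) < q (h, j)" using ij that by (simp add: q)
  qed
  have qP: "q (h, j) \<in> P h" if "h < n" "j \<in> {1..k}" for h j
    using that bij_betw_elem[OF finP cardP[OF that(1)]] by (auto simp: q bij_betw_def)
  have inj: "inj_on q beads"
  proof (rule inj_onI)
    fix a b assume ab: "a \<in> beads" "b \<in> beads" "q a = q b"
    obtain h j h' j' where *: "a = (h, j)" "b = (h', j')" by (cases a, cases b) auto
    have "h = h'" using qP[of h j] qP[of h' j'] ab * by (simp add: P_def)
    moreover from this have "j = j'"
      using inj_onD[OF strict_mono_on_imp_inj_on[OF inc], of h j j'] ab * by simp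
    ultimately show "a = b" using * by simp
  qed
  have sub: "q a < n * k" if "a \<in> beads" for a
    using that qP by (cases a) (auto simp: P_def)
  have "q ` beads = {..<n * k}"
    using inj sub by (intro card_subset_eq) (auto simp: card_image card_cartesian_product)
  then have rank: "q \<in> rankings beads"
    using inj sub by (auto simp: rankings_def bij_betw_def card_cartesian_product q_def)
  have "word_of q = w"
  proof (rule nth_equalityI)
    show "length (word_of q) = length w" using len by simp
    fix p assume "p < length (word_of q)"
    then have "p \<in> q ` beads" using ranking_surj[OF rank] by simp
    then obtain h j where p: "p = q (h, j)" "h < n" "j \<in> {1..k}" by auto
    have "w ! p = h" using qP[OF p(2,3)] p(1) by (simp add: P_def)
    then show "word_of q ! p = w ! p" using word_of_nth[OF rank p(2,3)] p(1) by simp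
  qed
  with rank inc show thesis by (rule that)
qed

text \<open>For a ranking with increasing rows, both interlacing with initial sites \<open>S\<close> and being a walk from \<open>S\<close> mean that
  the occupancies stay in \<open>{0, 1}\<close>; on such rankings, taking words is a bijection.\<close>

lemma card_follows:
  assumes S: "S \<subseteq> {..<n}"
  shows "card {q \<in> rankings beads. follows S q} = card (walks n (n * k) S S)"
proof (rule bij_betw_same_card)
  show "bij_betw word_of {q \<in> rankings beads. follows S q} (walks n (n * k) S S)"
  proof (rule bij_betwI')
    fix q r assume "q \<in> {q \<in> rankings beads. follows S q}" "r \<in> {q \<in> rankings beads. follows S q}"
    then show "(word_of q = word_of r) = (q = r)"
      using word_of_inj[of q r] follows_rows_increasing[OF _ S] by blast
  next
    fix q assume "q \<in> {q \<in> rankings beads. follows S q}"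
    then have q: "q \<in> rankings beads" "follows S q" by auto
    have inc: "strict_mono_on {1..k} (\<lambda>j. q (h, j))" if "h < n" for h
      using follows_rows_increasing[OF q(1) S q(2) that] .
    have "count_list (word_of q) h = k" if "h < n" for h
    proof -
      have "{j \<in> {1..k}. q (h, j) < n * k} = {1..k}" using ranking_less[OF q(1)] that by auto
      then show ?thesis
        using count_list_word_of[OF q(1) that order_refl] by (simp add: num_below_def)
    qed
    then show "word_of q \<in> walks n (n * k) S S"
      unfolding closed_walks_eq[OF n S]
      using set_word_of[OF q(1)] follows_iff_occupancy[OF q(1) inc] q(2) by simp
  next
    fix w assume "w \<in> walks n (n * k) S S"
    then have w: "length w = n * k" "set w \<subseteq> {..<n}" "\<And>h. h < n \<Longrightarrow> count_list w h = k"
      "\<forall>i\<le>n * k. \<forall>h<n. occupancy n S (take i w) h \<in> {0, 1}"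
      by (simp_all add: closed_walks_eq[OF n S])
    obtain q where q: "q \<in> rankings beads" "\<And>h. h < n \<Longrightarrow> strict_mono_on {1..k} (\<lambda>j. q (h, j))" "word_of q = w"
      using word_of_surj[OF w(1-3)] by blast
    have "follows S q" using follows_iff_occupancy[OF q(1,2)] w(4) q(3) by simp
    then show "\<exists>q\<in>{q \<in> rankings beads. follows S q}. w = word_of q" using q by blast
  qed
qed

theorem card_bead_patterns:
  "card {q \<in> rankings beads. bead_pattern n k l (\<lambda>a. real (q a))} =
   (\<Sum>S | S \<subseteq> {..<n} \<and> card S = l. card (walks n (n * k) S S))"
proof -
  let ?Ss = "{S. S \<subseteq> {..<n} \<and> card S = l}"
  have union: "{q \<in> rankings beads. bead_pattern n k l (\<lambda>a. real (q a))} = (\<Union>S\<in>?Ss. {q \<in> rankings beads. follows S q})"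
    using bead_pattern_iff_follows(1) by blast
  have disjoint: "card (\<Union>S\<in>?Ss. {q \<in> rankings beads. follows S q}) = (\<Sum>S\<in>?Ss. card {q \<in> rankings beads. follows S q})"
  proof (rule card_UN_disjoint)
    show "finite ?Ss" by (rule finite_subset[of _ "Pow {..<n}"]) auto
    show "\<forall>S\<in>?Ss. finite {q \<in> rankings beads. follows S q}"
      using finite_rankings[of beads] by simp
    show "\<forall>S\<in>?Ss. \<forall>T\<in>?Ss. S \<noteq> T \<longrightarrow> {q \<in> rankings beads. follows S q} \<inter> {q \<in> rankings beads. follows T q} = {}"
    proof (intro ballI impI equals0I)
      fix S T q assume "S \<in> ?Ss" "T \<in> ?Ss" "S \<noteq> T"
        and "q \<in> {q \<in> rankings beads. follows S q} \<inter> {q \<in> rankings beads. follows T q}"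
      then show False
        using bead_pattern_iff_follows(2)[of q S] bead_pattern_iff_follows(2)[of q T] by simp
    qed
  qed
  have count: "(\<Sum>S\<in>?Ss. card {q \<in> rankings beads. follows S q}) = (\<Sum>S\<in>?Ss. card (walks n (n * k) S S))"
  proof (rule sum.cong[OF refl])
    fix S assume "S \<in> ?Ss"
    then have "S \<subseteq> {..<n}" by blast
    then show "card {q \<in> rankings beads. follows S q} = card (walks n (n * k) S S)" by (rule card_follows)
  qed
  show ?thesis unfolding union disjoint count ..
qed

end

theorem corollary1p3:
  fixes n k l :: nat
  assumes "n \<ge> 2" and "k \<ge> 1" and "1 \<le> l" and "l \<le> n - 1"
  shows "complex_of_real (bead_volume n k l) =
    (-1) ^ (k * (l + 1)) / fact (n * k) *
      (\<Sum>J | J \<subseteq> {0..n - 1} \<and> card J = l.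
         (\<Sum>j\<in>J. exp (2 * complex_of_real pi * \<i> * of_nat j / of_nat n)) ^ (n * k))"
proof -
  \<comment> \<open>An \<open>n\<close>-th root of \<open>(-1)\<^bsup>l - 1\<^esup>\<close>, which accounts for the sign of a full turn of one particle.\<close>
  define \<zeta> where "\<zeta> = exp (\<i> * of_real pi * of_nat (l - 1) / of_nat n)"
  have "\<zeta> ^ n = exp (\<i> * of_real pi) ^ (l - 1)"
    unfolding \<zeta>_def exp_of_nat_mult[symmetric] using assms(1) by (intro arg_cong[of _ _ exp]) simp
  then have zeta: "\<zeta> ^ n = (-1) ^ (l - 1)" using exp_pi_i' by simp
  have "\<zeta> ^ (n * k) = (-1) ^ ((l - 1) * k)" by (simp add: power_mult zeta)
  also have "\<dots> = (-1) ^ (k * (l + 1))"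
    using assms(3) by (cases l) (auto simp: minus_one_power_iff)
  finally have zeta_nk: "\<zeta> ^ (n * k) = (-1) ^ (k * (l + 1))" .
  have range: "{0..n - 1} = {..<n}" using assms(1) by auto
  have "complex_of_real (bead_volume n k l) =
      of_nat (card {q \<in> rankings ({..<n} \<times> {1..k}). bead_pattern n k l (\<lambda>a. real (q a))}) / fact (n * k)"
    using assms by (simp add: bead_volume_eq_card)
  also have "\<dots> = (\<Sum>S | S \<subseteq> {..<n} \<and> card S = l. of_nat (card (walks n (n * k) S S))) / fact (n * k)"
    unfolding card_bead_patterns[OF assms(1,2)] by simp
  also have "(\<Sum>S | S \<subseteq> {..<n} \<and> card S = l. of_nat (card (walks n (n * k) S S))) =
      (\<Sum>J | J \<subseteq> {..<n} \<and> card J = l. (\<Sum>j\<in>J. \<zeta> * unit_root n j) ^ (n * k))"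
    using assms(1) zeta by (rule sum_closed_walks) simp
  also have "\<dots> = (-1) ^ (k * (l + 1)) * (\<Sum>J | J \<subseteq> {..<n} \<and> card J = l. (\<Sum>j\<in>J. unit_root n j) ^ (n * k))"
    by (simp add: power_mult_distrib zeta_nk flip: sum_distrib_left)
  finally show ?thesis by (simp only: range unit_root_def times_divide_eq_left)
qed

end
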